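(* Let $\mathbb{F}$ be a finite field and $d\ge0$ an integer. Consider the Polynomial Interpolation problem: given $q$ quantum queries to a polynomial $A:\mathbb{F}\to\mathbb{F}$ drawn uniformly at random from the polynomials of degree at most $d$, output the $d+1$ coefficients of $A$. The maximum success probability of any $q$-query quantum algorithm for this problem is (1) at most $\frac{1}{|\mathbb{F}|}$ if $q\le\frac d2$; (2) between $\frac{1}{q!}\left(1-\binom{q+1}{2}\frac{1}{|\mathbb{F}|}\right)$ and $\frac1{q!}$ if $q=\frac d2+\frac12$; (3) at least $1-\frac{(d/2+1)!+d+1}{|\mathbb{F}|}$ if $q\ge\frac d2+1$.
   Context: A quantum query to $A$ is the unitary $|x,y,z\rangle\mapsto|x,y+A(x),z\rangle$ for $x,y\in\mathbb{F}$ (addition in $\mathbb{F}$); queries may be adaptive. Success probability is averaged over the uniformly random polynomial $A$.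
   Formalization: The upper bound 1/q! in (2) is stated only for q ≤ |F|; it fails in general, e.g. |F|=2, d=13, q=7, where the maximum is 1/4096 > 1/7!. Polynomials are formal coefficient vectors, and (d/2+1)! for odd d means Γ(d/2+2). *)

theory Defs
  imports "HOL-Analysis.Analysis" "HOL-Computational_Algebra.Polynomial"
begin

(* The computational basis state |x,y,z> is the triple (x, y, z); the workspace register z
   takes the values 0, ..., m - 1.  Amplitude functions and kernels are only ever evaluated on
   basis m, so a state is a vector of dimension |F|^2 * m and an operator a square matrix of
   that size. *)

type_synonym 'a label = "'a \<times> 'a \<times> nat"
type_synonym 'a state = "'a label \<Rightarrow> complex"
type_synonym 'a operator = "'a label \<Rightarrow> 'a label \<Rightarrow> complex"

definition basis :: "nat \<Rightarrow> 'a label set" where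
  "basis m = UNIV \<times> UNIV \<times> {..<m}"

definition apply_operator :: "nat \<Rightarrow> 'a operator \<Rightarrow> 'a state \<Rightarrow> 'a state" where
  "apply_operator m U \<psi> = (\<lambda>b. \<Sum>c\<in>basis m. U b c * \<psi> c)"

definition is_unitary :: "nat \<Rightarrow> 'a operator \<Rightarrow> bool" where
  "is_unitary m U \<longleftrightarrow>
     (\<forall>a\<in>basis m. \<forall>b\<in>basis m.
        (\<Sum>c\<in>basis m. cnj (U c a) * U c b) = (if a = b then 1 else 0) \<and>
        (\<Sum>c\<in>basis m. U a c * cnj (U b c)) = (if a = b then 1 else 0))"

definition ket :: "'a label \<Rightarrow> 'a state" where
  "ket b = (\<lambda>c. if c = b then 1 else 0)"

(* Linear extension of |x,y,z> |-> |x,y+A(x),z>: the amplitude of |x,y,z> after the query is the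
   amplitude of its preimage |x,y-A(x),z> before it, see query_ket. *)
definition query :: "'a::field poly \<Rightarrow> 'a state \<Rightarrow> 'a state" where
  "query A \<psi> = (\<lambda>(x, y, z). \<psi> (x, y - poly A x, z))"

lemma query_ket: "query A (ket (x, y, z)) = ket (x, y + poly A x, z)"
  by (auto simp: query_def ket_def fun_eq_iff algebra_simps)

(* The initial state is an arbitrary unit vector that does not depend on the input A.  The
   unitary "unitaries k" is applied after query number k + 1.  At the end all registers are
   measured in the computational basis and the outcome b is post-processed to the coefficient
   list "output b".  Mixed states, intermediate measurements and generalised final measurements
   are covered by enlarging the workspace, whose dimension is part of the algorithm. *)
record 'a query_algorithm =
  workspace :: nat
  initial :: "'a state"
  unitaries :: "nat \<Rightarrow> 'a operator"
  "output" :: "'a label \<Rightarrow> 'a list"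

definition is_query_algorithm :: "nat \<Rightarrow> 'a query_algorithm \<Rightarrow> bool" where
  "is_query_algorithm q \<A> \<longleftrightarrow>
     (\<Sum>b\<in>basis (workspace \<A>). (cmod (initial \<A> b))\<^sup>2) = 1 \<and>
     (\<forall>k<q. is_unitary (workspace \<A>) (unitaries \<A> k))"

fun state_after :: "'a::field query_algorithm \<Rightarrow> 'a poly \<Rightarrow> nat \<Rightarrow> 'a state" where
  "state_after \<A> A 0 = initial \<A>"
| "state_after \<A> A (Suc k) =
     apply_operator (workspace \<A>) (unitaries \<A> k) (query A (state_after \<A> A k))"

definition coeff_list :: "nat \<Rightarrow> 'a::zero poly \<Rightarrow> 'a list" where
  "coeff_list d A = map (coeff A) [0..<d + 1]"

definition success_on :: "nat \<Rightarrow> nat \<Rightarrow> 'a::field query_algorithm \<Rightarrow> 'a poly \<Rightarrow> real" where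
  "success_on d q \<A> A =
     (\<Sum>b\<in>{b \<in> basis (workspace \<A>). output \<A> b = coeff_list d A}.
        (cmod (state_after \<A> A q b))\<^sup>2)"

definition polys_upto :: "nat \<Rightarrow> 'a::zero poly set" where
  "polys_upto d = {A. degree A \<le> d}"

definition success_probability :: "nat \<Rightarrow> nat \<Rightarrow> 'a::field query_algorithm \<Rightarrow> real" where
  "success_probability d q \<A> =
     (\<Sum>A\<in>polys_upto d. success_on d q \<A> A) / real (card (polys_upto d :: 'a poly set))"

definition is_max_success_probability ::
    "'a::{field,finite} itself \<Rightarrow> nat \<Rightarrow> nat \<Rightarrow> real \<Rightarrow> bool" where
  "is_max_success_probability F d q p \<longleftrightarrow>
     (\<exists>\<A> :: 'a query_algorithm. is_query_algorithm q \<A> \<and> success_probability d q \<A> = p) \<and>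
     (\<forall>\<A> :: 'a query_algorithm. is_query_algorithm q \<A> \<longrightarrow> success_probability d q \<A> \<le> p)"

(* x! for real x, needed at half-integers. *)
definition real_fact :: "real \<Rightarrow> real" where
  "real_fact x = Gamma (x + 1)"

lemma real_fact_of_nat: "real_fact (real n) = fact n"
  by (simp add: real_fact_def Gamma_fact add.commute)

end

theory Submission
  imports Defs
begin

text \<open>
  The maximum equals \<open>|R| / |F|\<^sup>d\<^sup>+\<^sup>1\<close>, where \<open>R\<close> is the set of vectors
  \<open>\<Sum>k<q. c\<^sub>k (1, x\<^sub>k, \<dots>, x\<^sub>k\<^sup>d)\<close>.  With respect to a nontrivial additive character
  \<open>\<omega>\<close>, the amplitudes after \<open>q\<close> queries are, as functions of the coefficient vector of \<open>A\<close>,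
  combinations of the characters \<open>\<omega> (r \<bullet> A)\<close> with \<open>r \<in> R\<close>; the Cauchy-Schwarz inequality and
  Parseval's identity bound the success probability.  Conversely, the uniform superposition of
  the characters in \<open>R\<close> can be prepared and Fourier-inverted.

  The bounds on \<open>|R|\<close> rest on the linear independence of any \<open>d + 1\<close> evaluation vectors.  For
  \<open>2 q = d + 1\<close>, combinations with \<open>q\<close> nonzero coefficients are pairwise distinct.  For larger \<open>q\<close>,
  a second-moment argument applies to combinations with exactly \<open>k\<close> nonzero coefficients, where
  \<open>k\<close> is the least integer with \<open>2 k \<ge> d + 2\<close>.
\<close>

section \<open>Additive characters of a finite field\<close>

text \<open>Values on the unit circle turn inverses into conjugates; nontriviality makes the
  character sums below vanish.\<close>

locale additive_character =
  fixes \<omega> :: "'a::{field,finite} \<Rightarrow> complex"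
  assumes char_add: "\<omega> (a + b) = \<omega> a * \<omega> b"
    and norm_char: "cmod (\<omega> a) = 1"
    and char_nontrivial: "\<exists>a. \<omega> a \<noteq> 1"
begin

lemma char_0 [simp]: "\<omega> 0 = 1"
  using char_add[of 0 0] norm_char[of 0] by auto

lemma char_minus: "\<omega> (- a) = cnj (\<omega> a)"
proof -
  have "\<omega> (- a) * \<omega> a = 1"
    by (simp flip: char_add)
  moreover have "cnj (\<omega> a) * \<omega> a = 1"
    using complex_norm_square[of "\<omega> a"] norm_char[of a] by (simp add: mult.commute)
  ultimately show ?thesis
    by (metis mult_right_cancel mult_zero_right zero_neq_one)
qed

lemma char_diff: "\<omega> (a - b) = \<omega> a * cnj (\<omega> b)"
  using char_add[of a "- b"] by (simp add: char_minus)

lemma sum_char: "(\<Sum>c\<in>UNIV. \<omega> (c * t)) = (if t = 0 then of_nat CARD('a) else 0)"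
proof (cases "t = 0")
  case False
  obtain a where a: "\<omega> a \<noteq> 1"
    using char_nontrivial by blast
  \<comment> \<open>Translating \<open>c\<close> by \<open>a / t\<close> multiplies the sum by
    \<open>\<omega> a\<close>, which is not 1, so the sum is 0.\<close>
  have "(\<Sum>c\<in>UNIV. \<omega> (c * t)) = (\<Sum>c\<in>UNIV. \<omega> ((c + a / t) * t))"
    by (rule sum.reindex_bij_betw[symmetric], rule bij_betw_byWitness[where f' = "\<lambda>c. c - a / t"]) auto
  also have "\<dots> = \<omega> a * (\<Sum>c\<in>UNIV. \<omega> (c * t))"
    unfolding sum_distrib_left using False
    by (intro sum.cong refl) (simp add: distrib_right char_add)
  finally show ?thesis
    using a False by auto
qed simp

text \<open>Interchanging the sums leaves \<open>sum_char\<close> at \<open>t - s\<close>, which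
  selects \<open>s = t\<close>. It serves for the second register, on which a query acts by
  translation.\<close>

lemma Fourier_inversion:
  fixes f :: "'a \<Rightarrow> complex"
  shows "f t = (\<Sum>c\<in>UNIV. (\<Sum>s\<in>UNIV. f s * \<omega> (- (c * s))) / of_nat CARD('a) * \<omega> (c * t))"
proof -
  have "(\<Sum>c\<in>UNIV. (\<Sum>s\<in>UNIV. f s * \<omega> (- (c * s))) / of_nat CARD('a) * \<omega> (c * t))
      = (\<Sum>c\<in>UNIV. \<Sum>s\<in>UNIV. f s * \<omega> (c * (t - s)) / of_nat CARD('a))"
    unfolding sum_divide_distrib sum_distrib_right
    by (intro sum.cong refl) (simp add: right_diff_distrib char_diff char_minus)
  also have "\<dots> = (\<Sum>s\<in>UNIV. f s * (\<Sum>c\<in>UNIV. \<omega> (c * (t - s))) / of_nat CARD('a))"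
    by (subst sum.swap) (simp add: sum_divide_distrib sum_distrib_left)
  also have "\<dots> = (\<Sum>s\<in>UNIV. if s = t then f t else 0)"
    by (intro sum.cong refl) (auto simp: sum_char)
  finally show ?thesis
    by simp
qed

end

text \<open>A maximal proper additive subgroup \<open>H\<close> has index the characteristic \<open>p\<close>; the character
  sends \<open>h + i g\<close> to the \<open>i\<close>-th power of a primitive \<open>p\<close>-th root of unity.\<close>

lemma ex_additive_character:
  "\<exists>\<omega> :: 'a::{field,finite} \<Rightarrow> complex. additive_character \<omega>"
proof -
  define sg where "sg H \<longleftrightarrow> (0::'a) \<in> H \<and> (\<forall>x\<in>H. \<forall>y\<in>H. x - y \<in> H) \<and> H \<noteq> UNIV" for H
  have "{0::'a} \<noteq> UNIV"
    by (metis UNIV_I singletonD zero_neq_one)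
  hence "sg {0}"
    by (simp add: sg_def)
  hence "{H. sg H} \<noteq> {}"
    by blast
  then obtain H where H: "sg H" and Hmax: "\<And>K. sg K \<Longrightarrow> H \<subseteq> K \<Longrightarrow> K = H"
    using finite_has_maximal[of "{H. sg H}"] by auto
  have Hdiff: "x - y \<in> H" if "x \<in> H" "y \<in> H" for x y
    using H that by (auto simp: sg_def)
  have H0: "0 \<in> H"
    using H by (auto simp: sg_def)
  have Hminus: "- y \<in> H" if "y \<in> H" for y
    using Hdiff[OF H0 that] by simp
  have Hadd: "x + y \<in> H" if "x \<in> H" "y \<in> H" for x y
    using Hdiff[OF that(1) Hminus[OF that(2)]] by simp
  have Hnat: "of_nat k * x \<in> H" if "x \<in> H" for x k
    by (induction k) (auto simp: H0 distrib_right intro: Hadd that)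
  have Hint: "of_int k * x \<in> H" if "x \<in> H" for x k
    using Hnat[OF that, of "nat k"] Hminus[OF Hnat[OF that, of "nat (- k)"]]
    by (cases "k \<ge> 0") auto
  obtain g where g: "g \<notin> H"
    using H by (auto simp: sg_def)
  define K where "K = {x. \<exists>i. x - of_int i * g \<in> H}"
  \<comment> \<open>\<open>K\<close> is the subgroup generated by \<open>H\<close> and
    \<open>g\<close>. It is strictly larger than \<open>H\<close>, so by maximality it cannot be
    proper.\<close>
  have "K = UNIV"
  proof (rule ccontr)
    assume "K \<noteq> UNIV"
    moreover have "x - y \<in> K" if xy: "x \<in> K" "y \<in> K" for x y
    proof -
      obtain i where "x - of_int i * g \<in> H"
        using xy(1) unfolding K_def mem_Collect_eq ..
      moreover obtain j where "y - of_int j * g \<in> H"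
        using xy(2) unfolding K_def mem_Collect_eq ..
      ultimately have "(x - y) - of_int (i - j) * g \<in> H"
        using Hdiff[of "x - of_int i * g" "y - of_int j * g"] by (simp add: algebra_simps)
      thus ?thesis
        unfolding K_def by blast
    qed
    moreover have HK: "H \<subseteq> K"
      unfolding K_def by (auto intro!: exI[of _ 0])
    ultimately have "sg K"
      using H0 by (auto simp: sg_def)
    hence "K = H"
      using Hmax HK by blast
    moreover have "g \<in> K"
      unfolding K_def using H0 by (auto intro!: exI[of _ 1])
    ultimately show False
      using g by simp
  qed
  hence "\<forall>x. \<exists>i. x - of_int i * g \<in> H"
    by (auto simp: K_def)
  then obtain I where I: "\<And>x. x - of_int (I x) * g \<in> H"
    by metis
  define p where "p = CHAR('a)"
  have p: "prime p"
    unfolding p_def using finite_imp_CHAR_pos[where ?'a = 'a] prime_CHAR_semidom[where ?'a = 'a] by simp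
  have ofp: "of_nat p = (0::'a)"
    by (simp add: p_def)
  \<comment> \<open>Otherwise \<open>i\<close> is invertible modulo \<open>p\<close>, and by Bezout
    some integer multiple of \<open>of_int i * g\<close> is \<open>g\<close> itself, which would
    then lie in \<open>H\<close>.\<close>
  have pdvd: "int p dvd i" if "of_int i * g \<in> H" for i
  proof (rule ccontr)
    assume "\<not> int p dvd i"
    hence "coprime i (int p)"
      using p by (metis coprime_commute prime_imp_coprime prime_int_iff prime_nat_int_transfer)
    then obtain u v where "u * i + v * int p = 1"
      by (metis bezout_int coprime_imp_gcd_eq_1)
    hence "of_int (u * i + v * int p) = (1::'a)"
      by simp
    hence "of_int u * of_int i = (1::'a)"
      using ofp by simp
    hence "of_int u * (of_int i * g) = g"
      by (metis mult.assoc mult_1_left)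
    thus False
      using Hint[OF that, of u] g by metis
  qed
  define \<omega> where "\<omega> x = cis (2 * pi * (real_of_int (I x) / real p))" for x
  \<comment> \<open>The index \<open>I x\<close> is determined only modulo \<open>p\<close>;
    changing it by a multiple of \<open>p\<close> adds full turns to the angle. This makes
    \<open>\<omega>\<close> additive whatever choice \<open>I\<close> makes.\<close>
  have chi_eq: "cis (2 * pi * (real_of_int i / real p)) = cis (2 * pi * (real_of_int j / real p))"
    if ij: "of_int (i - j) * g \<in> H" for i j
  proof -
    obtain k where "i - j = int p * k"
      using pdvd[OF ij] by (auto elim: dvdE)
    hence "i = j + int p * k"
      by simp
    hence "real_of_int i / real p = real_of_int j / real p + real_of_int k"
      using prime_gt_0_nat[OF p] by (simp add: add_divide_distrib)
    thus ?thesis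
      by (simp add: distrib_left flip: cis_mult)
  qed
  have "\<omega> (x + y) = \<omega> x * \<omega> y" for x y
  proof -
    have "of_int (I (x + y) - (I x + I y)) * g
        = (x - of_int (I x) * g) + (y - of_int (I y) * g) - ((x + y) - of_int (I (x + y)) * g)"
      by (simp add: algebra_simps)
    also have "\<dots> \<in> H"
      by (intro Hadd Hdiff I)
    finally show ?thesis
      unfolding \<omega>_def by (subst chi_eq[of _ "I x + I y"])
        (simp_all add: cis_mult add_divide_distrib distrib_left)
  qed
  moreover have "\<omega> g \<noteq> 1"
  proof -
    have "of_int (I g - 1) * g = - (g - of_int (I g) * g)"
      by (simp add: algebra_simps)
    hence "of_int (I g - 1) * g \<in> H"
      using I Hminus by metis
    hence "\<omega> g = cis (2 * pi * (1 / real p))"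
      unfolding \<omega>_def using chi_eq[of "I g" 1] by simp
    moreover have "cis (2 * pi * (1 / real p)) \<noteq> 1"
    proof
      assume "cis (2 * pi * (1 / real p)) = 1"
      hence "cos (2 * pi * (1 / real p)) = 1"
        by (simp add: complex_eq_iff)
      then obtain n where "2 * pi * (1 / real p) = real_of_int n * 2 * pi"
        by (auto simp: cos_one_2pi_int)
      hence "real p * real_of_int n = 1"
        using prime_gt_0_nat[OF p] by (simp add: field_simps)
      hence "real_of_int (int p * n) = 1"
        by simp
      hence "int p * n = 1"
        by linarith
      thus False
        using prime_gt_1_nat[OF p] by (simp add: zmult_eq_1_iff)
    qed
    ultimately show ?thesis
      by simp
  qed
  ultimately have "additive_character \<omega>"
    by unfold_locales (auto simp: \<omega>_def)
  thus ?thesis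
    by blast
qed

section \<open>Evaluation vectors and their linear combinations\<close>

text \<open>Vectors of length \<open>d + 1\<close> are represented by polynomials of degree at most \<open>d\<close>.\<close>

definition dual_pairing :: "nat \<Rightarrow> 'a::field poly \<Rightarrow> 'a poly \<Rightarrow> 'a" where
  "dual_pairing d r A = (\<Sum>j\<le>d. coeff r j * coeff A j)"

definition eval_vec :: "nat \<Rightarrow> 'a::field \<Rightarrow> 'a poly" where
  "eval_vec d x = (\<Sum>j\<le>d. monom (x ^ j) j)"

definition combine :: "nat \<Rightarrow> ('a \<Rightarrow> 'a) \<Rightarrow> 'a::{field,finite} poly" where
  "combine d w = (\<Sum>s\<in>UNIV. smult (w s) (eval_vec d s))"

definition supp :: "('a \<Rightarrow> 'a::zero) \<Rightarrow> 'a set" where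
  "supp w = {s. w s \<noteq> 0}"

text \<open>Bounding the support, rather than listing \<open>q\<close> summands, absorbs repeated
  points and zero coefficients. \<open>reachable_Suc\<close> and \<open>reachable_enum\<close> link
  the two descriptions.\<close>

definition reachable :: "nat \<Rightarrow> nat \<Rightarrow> 'a::{field,finite} poly set" where
  "reachable d q = combine d ` {w. card (supp w) \<le> q}"

lemma coeff_eval_vec: "coeff (eval_vec d x) j = (if j \<le> d then x ^ j else 0)"
  by (simp add: eval_vec_def coeff_sum)

section \<open>Polynomials of degree at most \<open>d\<close> as coefficient vectors\<close>

lemma polys_upto_eval_vec: "eval_vec d x \<in> polys_upto d"
  by (auto simp: polys_upto_def coeff_eval_vec intro!: degree_le)

lemma polys_upto_add: "A \<in> polys_upto d \<Longrightarrow> B \<in> polys_upto d \<Longrightarrow> A + B \<in> polys_upto d"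
  by (auto simp: polys_upto_def intro: degree_add_le)

lemma polys_upto_diff:
  fixes A B :: "'a::ab_group_add poly"
  shows "A \<in> polys_upto d \<Longrightarrow> B \<in> polys_upto d \<Longrightarrow> A - B \<in> polys_upto d"
  by (auto simp: polys_upto_def intro: degree_diff_le)

lemma polys_upto_combine: "combine d w \<in> polys_upto d"
  using polys_upto_eval_vec[of d]
  by (auto simp: polys_upto_def combine_def intro!: degree_sum_le intro: order.trans[OF degree_smult_le])

text \<open>This counts the inputs and shows that a measured outcome can be the correct answer for
  at most one of them.\<close>

lemma bij_betw_coeff_list:
  "bij_betw (coeff_list d) (polys_upto d) {xs :: 'a::zero list. length xs = d + 1}"
proof (rule bij_betw_byWitness[where f' = Poly])
  show "\<forall>A\<in>polys_upto d. Poly (coeff_list d A) = A"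
    by (auto simp: polys_upto_def coeff_list_def poly_eq_iff nth_default_def coeff_eq_0
        simp del: upt_Suc)
  show "\<forall>xs\<in>{xs :: 'a list. length xs = d + 1}. coeff_list d (Poly xs) = xs"
    by (auto simp: coeff_list_def nth_default_def intro!: nth_equalityI simp del: upt_Suc)
  show "coeff_list d ` polys_upto d \<subseteq> {xs :: 'a list. length xs = d + 1}"
    by (auto simp: coeff_list_def)
  show "Poly ` {xs :: 'a list. length xs = d + 1} \<subseteq> polys_upto d"
    by (auto simp: polys_upto_def nth_default_def intro!: degree_le)
qed

lemma finite_polys_upto: "finite (polys_upto d :: 'a::{zero,finite} poly set)"
  and card_polys_upto: "card (polys_upto d :: 'a poly set) = CARD('a) ^ (d + 1)"
proof -
  have "finite {xs :: 'a list. length xs = d + 1}"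
    using finite_lists_length_eq[of "UNIV :: 'a set" "d + 1"] by simp
  thus "finite (polys_upto d :: 'a poly set)"
    using bij_betw_finite[OF bij_betw_coeff_list] by blast
  show "card (polys_upto d :: 'a poly set) = CARD('a) ^ (d + 1)"
    using bij_betw_same_card[OF bij_betw_coeff_list[where ?'a = 'a, of d]]
      card_lists_length_eq[of "UNIV :: 'a set" "d + 1"] by simp
qed

lemma dual_pairing_commute: "dual_pairing d r A = dual_pairing d A r"
  by (simp add: dual_pairing_def mult.commute)

lemma dual_pairing_0 [simp]: "dual_pairing d 0 A = 0"
  by (simp add: dual_pairing_def)

lemma dual_pairing_add: "dual_pairing d (r + s) A = dual_pairing d r A + dual_pairing d s A"
  by (simp add: dual_pairing_def distrib_right sum.distrib)

lemma dual_pairing_add_right: "dual_pairing d r (A + B) = dual_pairing d r A + dual_pairing d r B"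
  by (simp add: dual_pairing_def distrib_left sum.distrib)

lemma dual_pairing_diff: "dual_pairing d (r - s) A = dual_pairing d r A - dual_pairing d s A"
  by (simp add: dual_pairing_def left_diff_distrib sum_subtractf)

lemma dual_pairing_smult: "dual_pairing d (smult c r) A = c * dual_pairing d r A"
  by (simp add: dual_pairing_def sum_distrib_left mult.assoc)

lemma dual_pairing_sum: "dual_pairing d (\<Sum>i\<in>I. r i) A = (\<Sum>i\<in>I. dual_pairing d (r i) A)"
  by (induction I rule: infinite_finite_induct) (auto simp: dual_pairing_add)

text \<open>Evaluation at \<open>x\<close> is linear in the coefficients, with vector (1, x, ...,
  x^d). Query answers thereby become pairings.\<close>

lemma dual_pairing_eval_vec: "A \<in> polys_upto d \<Longrightarrow> dual_pairing d (eval_vec d x) A = poly A x"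
  by (auto simp: dual_pairing_def coeff_eval_vec polys_upto_def poly_altdef coeff_eq_0 mult.commute
      dest: le_degree intro!: sum.mono_neutral_right)

lemma dual_pairing_monom: "j \<le> d \<Longrightarrow> dual_pairing d r (monom a j) = coeff r j * a"
proof -
  assume "j \<le> d"
  have "dual_pairing d r (monom a j) = (\<Sum>i\<le>d. if i = j then coeff r j * a else 0)"
    unfolding dual_pairing_def by (intro sum.cong) (auto simp: coeff_monom)
  thus ?thesis
    using \<open>j \<le> d\<close> by simp
qed

lemma combine_add: "combine d (\<lambda>s. v s + w s) = combine d v + combine d w"
  by (simp add: combine_def smult_add_left sum.distrib)

lemma combine_diff: "combine d (\<lambda>s. v s - w s) = combine d v - combine d w"
  by (simp add: combine_def smult_diff_left sum_subtractf)

lemma combine_single: "combine d (\<lambda>s. if s = x then c else 0) = smult c (eval_vec d x)"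
proof -
  have "combine d (\<lambda>s. if s = x then c else 0)
      = (\<Sum>s\<in>UNIV. if s = x then smult c (eval_vec d x) else 0)"
    unfolding combine_def by (intro sum.cong) auto
  thus ?thesis
    by simp
qed

text \<open>Pair the vanishing combination with the polynomial that vanishes on the support except at
  one point.\<close>

lemma combine_eq_0D:
  fixes w :: "'a::{field,finite} \<Rightarrow> 'a"
  assumes "combine d w = 0" and U: "supp w \<subseteq> U" "card U \<le> d + 1"
  shows "w = (\<lambda>_. 0)"
proof (rule ccontr)
  assume "w \<noteq> (\<lambda>_. 0)"
  then obtain t where t: "w t \<noteq> 0"
    by auto
  hence "t \<in> U"
    using U by (auto simp: supp_def)
  define L where "L = (\<Prod>s\<in>U - {t}. [:- s, 1:])"
  have "degree L = card (U - {t})"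
    unfolding L_def by (subst degree_prod_sum_eq) auto
  hence L: "L \<in> polys_upto d"
    using U \<open>t \<in> U\<close> by (auto simp: polys_upto_def)
  have poly_L: "poly L s = 0 \<longleftrightarrow> s \<in> U - {t}" for s
    by (auto simp: L_def poly_prod)
  have "0 = dual_pairing d (combine d w) L"
    using assms by simp
  also have "\<dots> = (\<Sum>s\<in>UNIV. w s * poly L s)"
    by (simp add: combine_def dual_pairing_sum dual_pairing_smult dual_pairing_eval_vec L)
  also have "\<dots> = (\<Sum>s\<in>UNIV. if s = t then w t * poly L t else 0)"
    using U poly_L by (intro sum.cong) (auto simp: supp_def)
  also have "\<dots> = w t * poly L t"
    by simp
  finally show False
    using t poly_L by auto
qed

lemma reachable_0: "reachable d 0 = {0}"
proof -
  have "{w :: 'a \<Rightarrow> 'a. card (supp w) \<le> 0} = {\<lambda>_. 0}"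
    by (auto simp: supp_def)
  thus ?thesis
    by (simp add: reachable_def combine_def)
qed

text \<open>A further query contributes a multiple of one evaluation vector, which adds at most the
  point \<open>x\<close> to the support.\<close>

lemma reachable_Suc:
  assumes "r \<in> reachable d q"
  shows "r + smult c (eval_vec d x) \<in> reachable d (Suc q)"
proof -
  obtain w where w: "card (supp w) \<le> q" "r = combine d w"
    using assms by (auto simp: reachable_def)
  let ?v = "\<lambda>s. w s + (if s = x then c else 0)"
  have "supp ?v \<subseteq> insert x (supp w)"
    by (auto simp: supp_def split: if_splits)
  hence "card (supp ?v) \<le> card (insert x (supp w))"
    by (intro card_mono) auto
  also have "\<dots> \<le> Suc q"
    using w by (simp add: card_insert_if)
  finally have "combine d ?v \<in> reachable d (Suc q)"
    by (auto simp: reachable_def)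
  thus ?thesis
    by (simp only: combine_add combine_single w)
qed

lemma reachable_mono: "q \<le> q' \<Longrightarrow> reachable d q \<subseteq> reachable d q'"
  by (auto simp: reachable_def)

lemma reachable_subset_polys_upto: "reachable d q \<subseteq> polys_upto d"
  by (auto simp: reachable_def polys_upto_combine)

lemma finite_reachable: "finite (reachable d q :: 'a::{field,finite} poly set)"
  by (simp add: reachable_def)

lemma reachable_pos: "card (reachable d q :: 'a::{field,finite} poly set) > 0"
  using reachable_mono[of 0 q d] finite_reachable[of d q]
  by (auto simp: reachable_0 card_gt_0_iff)

lemma reachable_enum:
  assumes "r \<in> reachable d q"
  obtains x c where "r = (\<Sum>k<q. smult (c k) (eval_vec d (x k)))"
proof -
  obtain w where w: "card (supp w) \<le> q" "r = combine d w"
    using assms by (auto simp: reachable_def)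
  obtain f where f: "bij_betw f {..<card (supp w)} (supp w)"
    using ex_bij_betw_nat_finite[of "supp w"] by (auto simp: atLeast0LessThan)
  \<comment> \<open>Zero coefficients pad the sum to exactly \<open>q\<close> terms; the points
    \<open>f k\<close> beyond the support are then arbitrary.\<close>
  define c where "c k = (if k < card (supp w) then w (f k) else 0)" for k
  have "(\<Sum>k<q. smult (c k) (eval_vec d (f k)))
      = (\<Sum>k<card (supp w). smult (w (f k)) (eval_vec d (f k)))"
    using w(1) by (intro sum.mono_neutral_cong_right) (auto simp: c_def)
  also have "\<dots> = (\<Sum>s\<in>supp w. smult (w s) (eval_vec d s))"
    by (rule sum.reindex_bij_betw[OF f])
  also have "\<dots> = r"
    unfolding w combine_def by (intro sum.mono_neutral_left) (auto simp: supp_def)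
  finally show ?thesis
    using that by metis
qed

context additive_character
begin

lemma sum_char_dual_pairing:
  assumes "r \<in> polys_upto d"
  shows "(\<Sum>A\<in>polys_upto d. \<omega> (dual_pairing d r A))
    = (if r = 0 then of_nat (card (polys_upto d :: 'a poly set)) else 0)"
proof (cases "r = 0")
  case False
  then obtain j where j: "coeff r j \<noteq> 0"
    by (auto simp: poly_eq_iff)
  hence "j \<le> d"
    using assms by (auto simp: polys_upto_def dest: le_degree)
  obtain a where a: "\<omega> a \<noteq> 1"
    using char_nontrivial by blast
  \<comment> \<open>\<open>B\<close> is chosen so that its pairing with \<open>r\<close> is
    \<open>a\<close>; translation by \<open>B\<close> then kills the sum, as in
    \<open>sum_char\<close>.\<close>
  define B where "B = monom (a / coeff r j) j"
  have B: "B \<in> polys_upto d"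
    using \<open>j \<le> d\<close> unfolding B_def polys_upto_def by (auto intro: order.trans[OF degree_monom_le])
  have rB: "dual_pairing d r B = a"
    using j \<open>j \<le> d\<close> by (simp add: B_def dual_pairing_monom)
  have "(\<Sum>A\<in>polys_upto d. \<omega> (dual_pairing d r A))
      = (\<Sum>A\<in>polys_upto d. \<omega> (dual_pairing d r (A + B)))"
    by (rule sum.reindex_bij_betw[symmetric], rule bij_betw_byWitness[where f' = "\<lambda>A. A - B"])
      (auto intro: polys_upto_add polys_upto_diff B)
  also have "\<dots> = \<omega> a * (\<Sum>A\<in>polys_upto d. \<omega> (dual_pairing d r A))"
    by (simp add: dual_pairing_add_right char_add rB sum_distrib_left mult.commute)
  finally show ?thesis
    using a False by auto
qed simp

end

section \<open>Upper bound on the success probability\<close>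

lemma finite_basis [simp]: "finite (basis m :: 'a::finite label set)"
  by (simp add: basis_def)

lemma unitary_norm_preserving:
  assumes "is_unitary m U"
  shows "(\<Sum>b\<in>basis m. (cmod (apply_operator m U \<psi> b))\<^sup>2)
    = (\<Sum>b\<in>basis m. (cmod (\<psi> (b :: 'a::finite label)))\<^sup>2)"
proof -
  have "complex_of_real (\<Sum>b\<in>basis m. (cmod (apply_operator m U \<psi> b))\<^sup>2)
      = (\<Sum>b\<in>basis m. (\<Sum>c\<in>basis m. U b c * \<psi> c) * cnj (\<Sum>c\<in>basis m. U b c * \<psi> c))"
    by (simp only: apply_operator_def complex_norm_square of_real_sum)
  also have "\<dots> = (\<Sum>b\<in>basis m. \<Sum>c\<in>basis m. \<Sum>c'\<in>basis m.
      (cnj (U b c') * U b c) * (\<psi> c * cnj (\<psi> c')))"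
    by (simp add: sum_product mult_ac)
  also have "\<dots> = (\<Sum>c\<in>basis m. \<Sum>c'\<in>basis m.
      (\<Sum>b\<in>basis m. cnj (U b c') * U b c) * (\<psi> c * cnj (\<psi> c')))"
    by (rule trans[OF sum.swap], rule sum.cong[OF refl], rule trans[OF sum.swap])
      (simp add: sum_distrib_right)
  also have "\<dots> = (\<Sum>c\<in>basis m. \<Sum>c'\<in>basis m.
      if c' = c then \<psi> c * cnj (\<psi> c) else 0)"
    using assms by (intro sum.cong refl) (auto simp: is_unitary_def)
  also have "\<dots> = complex_of_real (\<Sum>c\<in>basis m. (cmod (\<psi> c))\<^sup>2)"
    by (simp add: complex_norm_square[symmetric] del: of_real_power)
  finally show ?thesis
    using of_real_eq_iff by blast
qed

text \<open>For a fixed \<open>A\<close>, a query merely permutes the basis states.\<close>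

lemma query_norm_preserving:
  "(\<Sum>b\<in>basis m. (cmod (query A \<psi> b))\<^sup>2)
    = (\<Sum>b\<in>basis m. (cmod (\<psi> (b :: 'a::{field,finite} label)))\<^sup>2)"
proof -
  define h :: "'a label \<Rightarrow> 'a label" where "h = (\<lambda>(x, y, z). (x, y - poly A x, z))"
  have "bij_betw h (basis m) (basis m)"
    by (rule bij_betw_byWitness[where f' = "\<lambda>(x, y, z). (x, y + poly A x, z)"])
      (auto simp: h_def basis_def)
  hence "(\<Sum>b\<in>basis m. (cmod (\<psi> (h b)))\<^sup>2) = (\<Sum>b\<in>basis m. (cmod (\<psi> b))\<^sup>2)"
    by (rule sum.reindex_bij_betw)
  thus ?thesis
    by (simp add: query_def h_def case_prod_unfold)
qed

lemma state_after_norm: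
  fixes \<A> :: "'a::{field,finite} query_algorithm"
  assumes "is_query_algorithm q \<A>" "k \<le> q"
  shows "(\<Sum>b\<in>basis (workspace \<A>). (cmod (state_after \<A> A k b))\<^sup>2) = 1"
  using assms(2)
proof (induction k)
  case 0
  thus ?case
    using assms by (simp add: is_query_algorithm_def)
next
  case (Suc k)
  thus ?case
    using assms by (simp add: is_query_algorithm_def unitary_norm_preserving query_norm_preserving)
qed

context additive_character
begin

text \<open>Expanding the dependence on the second register in characters, a query at \<open>x\<close> multiplies
  the dependence on \<open>A\<close> by characters of the form \<open>\<omega> (c * poly A x)\<close>.\<close>

lemma query_expansion:
  assumes "\<And>A b. A \<in> polys_upto d \<Longrightarrow>
    \<psi> A b = (\<Sum>r\<in>reachable d k. \<omega> (dual_pairing d r A) * V r b)"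
  shows "\<exists>V'. \<forall>A\<in>polys_upto d. \<forall>b.
    query A (\<psi> A) b = (\<Sum>r\<in>reachable d (Suc k). \<omega> (dual_pairing d r A) * V' r b)"
proof -
  \<comment> \<open>\<open>F r x z c\<close> is the Fourier coefficient of \<open>V r\<close> at
    frequency \<open>c\<close> in the second register.\<close>
  define F where "F r x z c = (\<Sum>s\<in>UNIV. V r (x, s, z) * \<omega> (- (c * s))) / of_nat CARD('a)"
    for r and x :: 'a and z c
  \<comment> \<open>Translating the second register by \<open>poly A x\<close> gives frequency
    \<open>c\<close> the phase \<open>\<omega> (- (c * poly A x))\<close>, so the index
    \<open>r\<close> moves to \<open>g x (r, c)\<close>. \<open>V'\<close> collects all pairs that
    arrive at the same index.\<close>
  define g where "g x = (\<lambda>(r, c). r + smult (- c) (eval_vec d x))" for x :: 'a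
  define V' where "V' r = (\<lambda>(x, y, z).
    \<Sum>p\<in>{p \<in> reachable d k \<times> UNIV. g x p = r}. case p of (r, c) \<Rightarrow> F r x z c * \<omega> (c * y))" for r
  have "query A (\<psi> A) (x, y, z)
      = (\<Sum>r\<in>reachable d (Suc k). \<omega> (dual_pairing d r A) * V' r (x, y, z))"
    if A: "A \<in> polys_upto d" for A x y z
  proof -
    have "query A (\<psi> A) (x, y, z)
        = (\<Sum>r\<in>reachable d k. \<omega> (dual_pairing d r A) * V r (x, y - poly A x, z))"
      by (simp add: query_def assms A)
    also have "\<dots> = (\<Sum>r\<in>reachable d k. \<Sum>c\<in>UNIV.
        \<omega> (dual_pairing d r A) * (F r x z c * \<omega> (c * (y - poly A x))))"
      unfolding F_def sum_distrib_left[symmetric]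
      by (intro sum.cong refl arg_cong[where f = "(*) _"])
        (rule Fourier_inversion[of "\<lambda>s. V _ (x, s, z)"])
    also have "\<dots> = (\<Sum>r\<in>reachable d k. \<Sum>c\<in>UNIV.
        \<omega> (dual_pairing d (g x (r, c)) A) * (F r x z c * \<omega> (c * y)))"
      by (intro sum.cong refl)
        (simp add: g_def dual_pairing_diff dual_pairing_smult dual_pairing_eval_vec A
          right_diff_distrib char_diff)
    also have "\<dots> = (\<Sum>p\<in>reachable d k \<times> UNIV. \<omega> (dual_pairing d (g x p) A) *
        (case p of (r, c) \<Rightarrow> F r x z c * \<omega> (c * y)))"
      by (simp add: sum.cartesian_product case_prod_unfold)
    also have "\<dots> = (\<Sum>r\<in>reachable d (Suc k). \<Sum>p\<in>{p \<in> reachable d k \<times> UNIV. g x p = r}.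
        \<omega> (dual_pairing d (g x p) A) * (case p of (r, c) \<Rightarrow> F r x z c * \<omega> (c * y)))"
      by (rule sum.group[symmetric])
        (auto simp: finite_reachable g_def simp del: smult_minus_left intro: reachable_Suc)
    also have "\<dots> = (\<Sum>r\<in>reachable d (Suc k). \<omega> (dual_pairing d r A) * V' r (x, y, z))"
      by (simp add: V'_def sum_distrib_left)
    finally show ?thesis .
  qed
  thus ?thesis
    by (intro exI[of _ V'] ballI allI) (metis prod_cases3)
qed

text \<open>A query enlarges the set of available characters by one step; the unitaries do not
  depend on \<open>A\<close> and act only on the coefficients \<open>V\<close>.\<close>

lemma state_after_expansion:
  fixes \<A> :: "'a query_algorithm"
  shows "\<exists>V. \<forall>A\<in>polys_upto d. \<forall>b.
    state_after \<A> A k b = (\<Sum>r\<in>reachable d k. \<omega> (dual_pairing d r A) * V r b)"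
proof (induction k)
  case 0
  show ?case
    by (intro exI[of _ "\<lambda>_. initial \<A>"]) (simp add: reachable_0)
next
  case (Suc k)
  then obtain V where V: "\<forall>A\<in>polys_upto d. \<forall>b.
      state_after \<A> A k b = (\<Sum>r\<in>reachable d k. \<omega> (dual_pairing d r A) * V r b)" ..
  have "\<exists>V'. \<forall>A\<in>polys_upto d. \<forall>b. query A (state_after \<A> A k) b
      = (\<Sum>r\<in>reachable d (Suc k). \<omega> (dual_pairing d r A) * V' r b)"
    using V by (intro query_expansion[where V = V]) blast
  then obtain V' where "\<forall>A\<in>polys_upto d. \<forall>b. query A (state_after \<A> A k) b
      = (\<Sum>r\<in>reachable d (Suc k). \<omega> (dual_pairing d r A) * V' r b)" ..
  hence V': "query A (state_after \<A> A k) b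
      = (\<Sum>r\<in>reachable d (Suc k). \<omega> (dual_pairing d r A) * V' r b)"
    if "A \<in> polys_upto d" for A b
    using that by blast
  have "state_after \<A> A (Suc k) b = (\<Sum>r\<in>reachable d (Suc k). \<omega> (dual_pairing d r A) *
      apply_operator (workspace \<A>) (unitaries \<A> k) (V' r) b)"
    if "A \<in> polys_upto d" for A b
  proof -
    have "state_after \<A> A (Suc k) b = (\<Sum>c\<in>basis (workspace \<A>). \<Sum>r\<in>reachable d (Suc k).
        \<omega> (dual_pairing d r A) * (unitaries \<A> k b c * V' r c))"
      by (simp add: apply_operator_def V'[OF that] sum_distrib_left mult.left_commute)
    also have "\<dots> = (\<Sum>r\<in>reachable d (Suc k). \<Sum>c\<in>basis (workspace \<A>).
        \<omega> (dual_pairing d r A) * (unitaries \<A> k b c * V' r c))"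
      by (rule sum.swap)
    finally show ?thesis
      by (simp add: apply_operator_def sum_distrib_left)
  qed
  thus ?case
    by (intro exI[of _ "\<lambda>r. apply_operator (workspace \<A>) (unitaries \<A> k) (V' r)"]) blast
qed

lemma Parseval_polys_upto:
  assumes R: "R \<subseteq> polys_upto d"
    and f: "\<And>A. A \<in> polys_upto d \<Longrightarrow> f A = (\<Sum>r\<in>R. \<omega> (dual_pairing d r A) * v r)"
  shows "(\<Sum>A\<in>polys_upto d. (cmod (f A))\<^sup>2)
    = real (card (polys_upto d :: 'a poly set)) * (\<Sum>r\<in>R. (cmod (v r))\<^sup>2)"
proof -
  have fin: "finite R"
    using R finite_polys_upto finite_subset by blast
  have "complex_of_real (\<Sum>A\<in>polys_upto d. (cmod (f A))\<^sup>2)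
      = (\<Sum>A\<in>polys_upto d. (\<Sum>r\<in>R. \<omega> (dual_pairing d r A) * v r)
          * cnj (\<Sum>r\<in>R. \<omega> (dual_pairing d r A) * v r))"
    unfolding of_real_sum complex_norm_square by (intro sum.cong refl) (simp add: f)
  also have "\<dots> = (\<Sum>A\<in>polys_upto d. \<Sum>r\<in>R. \<Sum>s\<in>R.
      \<omega> (dual_pairing d (r - s) A) * (v r * cnj (v s)))"
    by (simp add: sum_product dual_pairing_diff char_diff mult_ac)
  also have "\<dots> = (\<Sum>r\<in>R. \<Sum>s\<in>R.
      (\<Sum>A\<in>polys_upto d. \<omega> (dual_pairing d (r - s) A)) * (v r * cnj (v s)))"
    by (rule trans[OF sum.swap], rule sum.cong[OF refl], rule trans[OF sum.swap])
      (simp add: sum_distrib_right)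
  also have "\<dots> = (\<Sum>r\<in>R. \<Sum>s\<in>R. if s = r then
      of_nat (card (polys_upto d :: 'a poly set)) * (v r * cnj (v r)) else 0)"
    using R by (intro sum.cong refl, subst sum_char_dual_pairing) (auto intro: polys_upto_diff)
  also have "\<dots> = complex_of_real
      (real (card (polys_upto d :: 'a poly set)) * (\<Sum>r\<in>R. (cmod (v r))\<^sup>2))"
    using fin by (simp add: sum_distrib_left complex_norm_square[symmetric] del: of_real_power)
  finally show ?thesis
    using of_real_eq_iff by blast
qed

text \<open>By Cauchy-Schwarz, each squared amplitude is at most \<open>card R\<close> times
  \<open>T b\<close>, which does not depend on \<open>A\<close>. Each outcome is correct for at most
  one \<open>A\<close>, and by Parseval the \<open>T b\<close> add up to the average squared norm,
  namely 1.\<close>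

lemma success_probability_le:
  fixes \<A> :: "'a query_algorithm"
  assumes alg: "is_query_algorithm q \<A>"
  shows "success_probability d q \<A>
    \<le> real (card (reachable d q :: 'a poly set)) / real (card (polys_upto d :: 'a poly set))"
proof -
  define N where "N = real (card (polys_upto d :: 'a poly set))"
  define R where "R = (reachable d q :: 'a poly set)"
  define B where "B = (basis (workspace \<A>) :: 'a label set)"
  have N: "N > 0"
    by (simp add: N_def card_polys_upto)
  obtain V where "\<forall>A\<in>polys_upto d. \<forall>b.
      state_after \<A> A q b = (\<Sum>r\<in>R. \<omega> (dual_pairing d r A) * V r b)"
    using state_after_expansion[of d \<A> q] unfolding R_def ..
  hence V: "state_after \<A> A q b = (\<Sum>r\<in>R. \<omega> (dual_pairing d r A) * V r b)"
    if "A \<in> polys_upto d" for A b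
    using that by blast
  define T where "T b = (\<Sum>r\<in>R. (cmod (V r b))\<^sup>2)" for b
  have state_le: "(cmod (state_after \<A> A q b))\<^sup>2 \<le> real (card R) * T b"
    if "A \<in> polys_upto d" for A b
  proof -
    have "cmod (state_after \<A> A q b) \<le> (\<Sum>r\<in>R. 1 * cmod (V r b))"
      unfolding V[OF that] by (rule order.trans[OF norm_sum]) (simp add: norm_mult norm_char)
    hence "(cmod (state_after \<A> A q b))\<^sup>2 \<le> (\<Sum>r\<in>R. 1 * cmod (V r b))\<^sup>2"
      by (intro power_mono) auto
    also have "\<dots> \<le> (\<Sum>r\<in>R. 1\<^sup>2) * (\<Sum>r\<in>R. (cmod (V r b))\<^sup>2)"
      by (rule Cauchy_Schwarz_ineq_sum)
    finally show ?thesis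
      by (simp add: T_def)
  qed
  have "(\<Sum>A\<in>polys_upto d. success_on d q \<A> A)
      \<le> (\<Sum>A\<in>polys_upto d. \<Sum>b\<in>{b \<in> B. output \<A> b = coeff_list d A}. real (card R) * T b)"
    unfolding success_on_def B_def by (intro sum_mono state_le)
  also have "\<dots> = (\<Sum>l\<in>coeff_list d ` polys_upto d. \<Sum>b\<in>{b \<in> B. output \<A> b = l}.
      real (card R) * T b)"
    using bij_betw_coeff_list[of d]
    by (subst sum.reindex) (auto simp: bij_betw_def)
  also have "\<dots> = (\<Sum>b\<in>(\<Union>l\<in>coeff_list d ` polys_upto d. {b \<in> B. output \<A> b = l}).
      real (card R) * T b)"
    by (subst sum.UNION_disjoint) (auto simp: B_def finite_polys_upto)
  \<comment> \<open>Outcomes that are correct for no polynomial are now included.\<close>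
  also have "\<dots> \<le> (\<Sum>b\<in>B. real (card R) * T b)"
    by (intro sum_mono2) (auto simp: B_def T_def sum_nonneg)
  also have "\<dots> = real (card R) * (\<Sum>b\<in>B. (\<Sum>A\<in>polys_upto d. (cmod (state_after \<A> A q b))\<^sup>2) / N)"
    unfolding sum_distrib_left
  proof (intro sum.cong refl)
    fix b
    have "(\<Sum>A\<in>polys_upto d. (cmod (state_after \<A> A q b))\<^sup>2) = N * T b"
      unfolding N_def T_def
      by (rule Parseval_polys_upto[OF _ V]) (simp_all add: R_def reachable_subset_polys_upto)
    thus "real (card R) * T b
        = real (card R) * ((\<Sum>A\<in>polys_upto d. (cmod (state_after \<A> A q b))\<^sup>2) / N)"
      using N by simp
  qed
  also have "\<dots> = real (card R) * ((\<Sum>A\<in>polys_upto d. \<Sum>b\<in>B. (cmod (state_after \<A> A q b))\<^sup>2) / N)"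
    by (subst sum.swap) (simp add: sum_divide_distrib)
  also have "\<dots> = real (card R)"
    using N by (simp add: B_def state_after_norm[OF alg] N_def)
  finally show ?thesis
    using N unfolding success_probability_def N_def R_def by (intro divide_right_mono) auto
qed

end

section \<open>An optimal algorithm\<close>

lemma sum_basis:
  fixes f :: "'a::finite label \<Rightarrow> 'b::comm_monoid_add"
  shows "(\<Sum>b\<in>basis m. f b) = (\<Sum>z<m. \<Sum>y\<in>UNIV. \<Sum>x\<in>UNIV. f (x, y, z))"
proof -
  have "(\<Sum>b\<in>basis m. f b) = (\<Sum>x\<in>UNIV. \<Sum>y\<in>UNIV. \<Sum>z<m. f (x, y, z))"
    by (simp add: basis_def sum.cartesian_product case_prod_unfold)
  also have "\<dots> = (\<Sum>y\<in>UNIV. \<Sum>x\<in>UNIV. \<Sum>z<m. f (x, y, z))"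
    by (rule sum.swap)
  also have "\<dots> = (\<Sum>y\<in>UNIV. \<Sum>z<m. \<Sum>x\<in>UNIV. f (x, y, z))"
    by (rule sum.cong[OF refl], rule sum.swap)
  also have "\<dots> = (\<Sum>z<m. \<Sum>y\<in>UNIV. \<Sum>x\<in>UNIV. f (x, y, z))"
    by (rule sum.swap)
  finally show ?thesis .
qed

lemma sum_sum_delta:
  fixes f :: "'a::finite \<Rightarrow> 'b::finite \<Rightarrow> 'c::comm_monoid_add"
  shows "(\<Sum>y\<in>UNIV. \<Sum>x\<in>UNIV. if y = y0 \<and> x = x0 then f x y else 0) = f x0 y0"
proof -
  have "(\<Sum>y\<in>UNIV. \<Sum>x\<in>UNIV. if y = y0 \<and> x = x0 then f x y else 0)
      = (\<Sum>y\<in>UNIV. if y = y0 then (\<Sum>x\<in>UNIV. if x = x0 then f x0 y0 else 0) else 0)"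
    by (intro sum.cong refl) auto
  thus ?thesis
    by simp
qed

context additive_character
begin

definition shift_operator ::
    "(nat \<Rightarrow> 'a) \<Rightarrow> (nat \<Rightarrow> 'a) \<Rightarrow> (nat \<Rightarrow> nat \<Rightarrow> complex) \<Rightarrow> 'a operator" where
  "shift_operator s t W = (\<lambda>(x', y', z') (x, y, z).
     if y = y' \<and> x = x' - s z then \<omega> (t z * y) * W z' z else 0)"

lemma char_mult_cnj: "\<omega> a * (cnj (\<omega> a) * c) = c" "cnj (\<omega> a) * (\<omega> a * c) = c"
  by (simp_all add: mult.assoc[symmetric] flip: char_minus char_add)

lemma char_mult_cnj_mult: "\<omega> a * b * (cnj (\<omega> a) * c) = b * c"
  using char_mult_cnj(1)[of a "b * c"] by (simp only: mult_ac)

lemma apply_shift_operator: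
  "apply_operator m (shift_operator s t W) \<psi> (x, y, z)
    = (\<Sum>z'<m. \<omega> (t z' * y) * W z z' * \<psi> (x - s z', y, z'))"
proof -
  have "apply_operator m (shift_operator s t W) \<psi> (x, y, z)
      = (\<Sum>z'<m. \<Sum>y'\<in>UNIV. \<Sum>x'\<in>UNIV. if y' = y \<and> x' = x - s z'
          then \<omega> (t z' * y') * W z z' * \<psi> (x', y', z') else 0)"
    unfolding apply_operator_def sum_basis
    by (intro sum.cong refl) (auto simp: shift_operator_def)
  thus ?thesis
    by (simp add: sum_sum_delta)
qed

lemma shift_operator_unitary:
  assumes W_cols: "\<And>a b. a < m \<Longrightarrow> b < m \<Longrightarrow>
      (\<Sum>z<m. cnj (W z a) * W z b) = (if a = b then 1 else 0)"
    and W_rows: "\<And>a b. a < m \<Longrightarrow> b < m \<Longrightarrow>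
      (\<Sum>z<m. W a z * cnj (W b z)) = (if a = b then 1 else 0)"
  shows "is_unitary m (shift_operator s t W)"
  unfolding is_unitary_def
proof (intro ballI conjI)
  fix a b :: "'a label"
  assume ab: "a \<in> basis m" "b \<in> basis m"
  obtain xa ya za where a: "a = (xa, ya, za)"
    by (cases a)
  obtain xb yb zb where b: "b = (xb, yb, zb)"
    by (cases b)
  have z: "za < m" "zb < m"
    using ab by (auto simp: a b basis_def)
  have "(\<Sum>c\<in>basis m. cnj (shift_operator s t W c a) * shift_operator s t W c b)
      = (\<Sum>z<m. \<Sum>y\<in>UNIV. \<Sum>x\<in>UNIV. if y = ya \<and> x = xa + s za then
          (if yb = ya \<and> xb + s zb = x then
            cnj (\<omega> (t za * ya)) * \<omega> (t zb * yb) * (cnj (W z za) * W z zb) else 0) else 0)"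
    unfolding sum_basis a b by (intro sum.cong refl) (auto simp: shift_operator_def)
  also have "\<dots> = (\<Sum>z<m. if yb = ya \<and> xb + s zb = xa + s za then
      cnj (\<omega> (t za * ya)) * \<omega> (t zb * yb) * (cnj (W z za) * W z zb) else 0)"
    by (simp only: sum_sum_delta)
  also have "\<dots> = (if yb = ya \<and> xb + s zb = xa + s za then
      cnj (\<omega> (t za * ya)) * \<omega> (t zb * yb) * (\<Sum>z<m. cnj (W z za) * W z zb) else 0)"
    by (cases "yb = ya \<and> xb + s zb = xa + s za")
      (simp_all only: if_True if_False sum_distrib_left sum.neutral_const simp_thms)
  \<comment> \<open>Orthonormality of the columns of \<open>W\<close> forces \<open>za = zb\<close>;
    only then do the shifts cancel and give \<open>xa = xb\<close>.\<close>
  also have "\<dots> = (if a = b then 1 else 0)"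
    using z by (auto simp: W_cols a b char_mult_cnj(2)[where c = 1, simplified])
  finally show "(\<Sum>c\<in>basis m. cnj (shift_operator s t W c a) * shift_operator s t W c b)
      = (if a = b then 1 else 0)" .
  have "(\<Sum>c\<in>basis m. shift_operator s t W a c * cnj (shift_operator s t W b c))
      = (\<Sum>z<m. \<Sum>y\<in>UNIV. \<Sum>x\<in>UNIV. if y = ya \<and> x = xa - s z then
          (if yb = ya \<and> xb = xa then W za z * cnj (W zb z) else 0) else 0)"
    unfolding sum_basis a b
    by (intro sum.cong refl) (auto simp: shift_operator_def char_mult_cnj_mult)
  also have "\<dots> = (if yb = ya \<and> xb = xa then (\<Sum>z<m. W za z * cnj (W zb z)) else 0)"
    unfolding sum_sum_delta by (cases "yb = ya \<and> xb = xa")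
      (simp_all only: if_True if_False sum.neutral_const simp_thms)
  also have "\<dots> = (if a = b then 1 else 0)"
    using z by (auto simp: W_rows a b)
  finally show "(\<Sum>c\<in>basis m. shift_operator s t W a c * cnj (shift_operator s t W b c))
      = (if a = b then 1 else 0)" .
qed

text \<open>If the workspace holds the index of a reachable \<open>r = \<Sum>k. c k * eval_vec (x k)\<close>, the second
  register is kept in the eigenvector of the query at \<open>x k\<close> with eigenvalue
  \<open>\<omega> (c k * poly A (x k))\<close>.  After all queries the state is a uniform superposition over \<open>r\<close>
  with phases \<open>\<omega> (dual_pairing d r A)\<close>, and the last unitary inverts this Fourier transform.\<close>

lemma ex_optimal_algorithm_Suc:
  assumes q: "q = Suc q'"
  shows "\<exists>\<A> :: 'a query_algorithm. is_query_algorithm q \<A> \<and> success_probability d q \<A>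
    = real (card (reachable d q :: 'a poly set)) / real (card (polys_upto d :: 'a poly set))"
proof -
  define P where "P = (polys_upto d :: 'a poly set)"
  define R where "R = (reachable d q :: 'a poly set)"
  define N where "N = card P"
  define n where "n = CARD('a)"
  define \<rho> where "\<rho> = card R"
  have pos: "N > 0" "n > 0" "\<rho> > 0"
    by (simp_all add: N_def P_def card_polys_upto n_def \<rho>_def R_def reachable_pos)
  have RP: "R \<subseteq> P" and finP: "finite P"
    by (simp_all add: R_def P_def reachable_subset_polys_upto finite_polys_upto)
  obtain g where g: "bij_betw g {..<N} P"
    using ex_bij_betw_nat_finite[OF finP] by (auto simp: N_def atLeast0LessThan)
  have gP: "g z \<in> P" if "z < N" for z
    using g that by (auto simp: bij_betw_def)
  have g_eq: "g a = g b \<longleftrightarrow> a = b" if "a < N" "b < N" for a b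
    using g that by (auto simp: bij_betw_def inj_on_def)
  have "\<exists>x c. r = (\<Sum>k<q. smult (c k) (eval_vec d (x k)))" if "r \<in> R" for r
    using reachable_enum[of r d q] that unfolding R_def by metis
  then obtain X C where XC: "\<And>r. r \<in> R \<Longrightarrow> r = (\<Sum>k<q. smult (C r k) (eval_vec d (X r k)))"
    by metis
  define xs where "xs z k = (if k < q then X (g z) k else 0)" for z k
  define cs where "cs z k = (if k < q then C (g z) k else 0)" for z k
  define \<alpha> where "\<alpha> z = (if g z \<in> R then complex_of_real (1 / sqrt \<rho>) else 0)" for z
  define W where "W k z' z = (if k = q' then cnj (\<omega> (dual_pairing d (g z') (g z))) / sqrt N
      else if z' = z then 1 else 0)" for k z' z
  define \<A> where "\<A> = \<lparr>workspace = N,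
    initial = (\<lambda>(x, y, z). if x = xs z 0 then \<alpha> z * \<omega> (- (cs z 0 * y)) / sqrt n else 0),
    unitaries = (\<lambda>k. shift_operator (\<lambda>z. xs z (Suc k) - xs z k) (\<lambda>z. cs z k - cs z (Suc k)) (W k)),
    output = (\<lambda>(x, y, z). coeff_list d (g z))\<rparr>"
  have sum_\<alpha>: "(\<Sum>z<N. if g z \<in> R then c else 0) = of_nat \<rho> * c" for c :: "'b::semiring_1"
  proof -
    have "(\<Sum>z<N. if g z \<in> R then c else 0) = (\<Sum>r\<in>P. if r \<in> R then c else 0)"
      by (rule sum.reindex_bij_betw[OF g])
    also have "\<dots> = (\<Sum>r\<in>P \<inter> R. c)"
      by (rule sum.inter_restrict[OF finP, symmetric])
    also have "\<dots> = of_nat \<rho> * c"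
      by (simp add: \<rho>_def Int_absorb1[OF RP])
    finally show ?thesis .
  qed
  have Fourier_rows: "(\<Sum>z<N. \<omega> (dual_pairing d (g a) (g z)) * cnj (\<omega> (dual_pairing d (g b) (g z))))
      = (if a = b then of_nat N else 0)" if ab: "a < N" "b < N" for a b
  proof -
    have "(\<Sum>z<N. \<omega> (dual_pairing d (g a) (g z)) * cnj (\<omega> (dual_pairing d (g b) (g z))))
        = (\<Sum>z<N. \<omega> (dual_pairing d (g a - g b) (g z)))"
      by (simp add: dual_pairing_diff char_diff)
    also have "\<dots> = (\<Sum>A\<in>P. \<omega> (dual_pairing d (g a - g b) A))"
      by (rule sum.reindex_bij_betw[OF g])
    also have "\<dots> = (if a = b then of_nat N else 0)"
      using gP ab g_eq unfolding P_def N_def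
      by (subst sum_char_dual_pairing) (auto intro: polys_upto_diff)
    finally show ?thesis .
  qed
  have sqrt_sq: "complex_of_real (sqrt (real k)) * complex_of_real (sqrt (real k)) = of_nat k" for k
    by (simp flip: of_real_mult)
  have "is_unitary N (unitaries \<A> k)" for k
    unfolding \<A>_def query_algorithm.simps
  proof (rule shift_operator_unitary)
    fix a b
    assume ab: "a < N" "b < N"
    show "(\<Sum>z<N. cnj (W k z a) * W k z b) = (if a = b then 1 else 0)"
    proof (cases "k = q'")
      case True
      have "(\<Sum>z<N. cnj (W k z a) * W k z b) = (\<Sum>z<N. \<omega> (dual_pairing d (g a) (g z)) *
          cnj (\<omega> (dual_pairing d (g b) (g z)))) / of_nat N"
        unfolding sum_divide_distrib using True
        by (intro sum.cong refl)
          (simp add: W_def sqrt_sq dual_pairing_commute[of d "g _" "g a"]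
            dual_pairing_commute[of d "g _" "g b"])
      thus ?thesis
        using pos by (simp add: Fourier_rows ab)
    next
      case False
      hence "(\<Sum>z<N. cnj (W k z a) * W k z b) = (\<Sum>z<N. if z = a then (if a = b then 1 else 0) else 0)"
        by (intro sum.cong refl) (auto simp: W_def)
      thus ?thesis
        using ab by simp
    qed
    show "(\<Sum>z<N. W k a z * cnj (W k b z)) = (if a = b then 1 else 0)"
    proof (cases "k = q'")
      case True
      have "(\<Sum>z<N. W k a z * cnj (W k b z)) = (\<Sum>z<N. \<omega> (dual_pairing d (g b) (g z)) *
          cnj (\<omega> (dual_pairing d (g a) (g z)))) / of_nat N"
        unfolding sum_divide_distrib using True
        by (intro sum.cong refl) (simp add: W_def sqrt_sq)
      thus ?thesis
        using pos by (simp add: Fourier_rows ab)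
    next
      case False
      hence "(\<Sum>z<N. W k a z * cnj (W k b z)) = (\<Sum>z<N. if z = a then (if a = b then 1 else 0) else 0)"
        by (intro sum.cong refl) (auto simp: W_def)
      thus ?thesis
        using ab by simp
    qed
  qed
  moreover have "(\<Sum>b\<in>basis N. (cmod (initial \<A> b))\<^sup>2) = 1"
  proof -
    have "(\<Sum>b\<in>basis N. (cmod (initial \<A> b))\<^sup>2)
        = (\<Sum>z<N. \<Sum>y\<in>(UNIV :: 'a set). \<Sum>x\<in>UNIV. if x = xs z 0 then (if g z \<in> R then 1 / (real \<rho> * real n) else 0) else 0)"
      unfolding sum_basis
      by (intro sum.cong refl)
        (auto simp: \<A>_def \<alpha>_def norm_mult norm_divide norm_char power_divide)
    also have "\<dots> = (\<Sum>z<N. if g z \<in> R then 1 / real \<rho> else 0)"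
      using pos by (intro sum.cong refl) (simp add: n_def)
    also have "\<dots> = 1"
      using pos by (simp add: sum_\<alpha>)
    finally show ?thesis .
  qed
  ultimately have alg: "is_query_algorithm q \<A>"
    by (simp add: is_query_algorithm_def \<A>_def)
  have workspace_eq: "workspace \<A> = N" and output_eq: "output \<A> (x, y, z) = coeff_list d (g z)" for x y z
    by (simp_all add: \<A>_def)
  have success: "success_on d q \<A> A = real \<rho> / real N" if A: "A \<in> P" for A
  proof -
    define ph where "ph z k = (\<Sum>i<k. cs z i * poly A (xs z i))" for z k
    define amp where "amp k x y z = (if x = xs z k
        then \<alpha> z * \<omega> (- (cs z k * y)) / sqrt n * \<omega> (ph z k) else 0)" for k x y z
    have step: "state_after \<A> A (Suc k) (x, y, z) = (\<Sum>z'<N. W k z z' * amp (Suc k) x y z')"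
      if IH: "\<And>x y z. z < N \<Longrightarrow> state_after \<A> A k (x, y, z) = amp k x y z" for k x y z
    proof -
      have "state_after \<A> A (Suc k) (x, y, z) = (\<Sum>z'<N. \<omega> ((cs z' k - cs z' (Suc k)) * y) *
          W k z z' * query A (state_after \<A> A k) (x - (xs z' (Suc k) - xs z' k), y, z'))"
        by (simp add: \<A>_def apply_shift_operator)
      also have "\<dots> = (\<Sum>z'<N. W k z z' * amp (Suc k) x y z')"
      proof (intro sum.cong refl)
        fix z'
        assume "z' \<in> {..<N}"
        hence query_eq: "query A (state_after \<A> A k) (x', y, z') = amp k x' (y - poly A x') z'" for x'
          by (simp add: query_def IH)
        have x_eq: "x - (xs z' (Suc k) - xs z' k) = xs z' k \<longleftrightarrow> x = xs z' (Suc k)"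
          by (auto simp: algebra_simps)
        have "(cs z' k - cs z' (Suc k)) * y + (- (cs z' k * (y - poly A (xs z' k))) + ph z' k)
            = - (cs z' (Suc k) * y) + ph z' (Suc k)"
          by (simp add: ph_def algebra_simps)
        hence "\<omega> ((cs z' k - cs z' (Suc k)) * y) * (\<omega> (- (cs z' k * (y - poly A (xs z' k)))) * \<omega> (ph z' k))
            = \<omega> (- (cs z' (Suc k) * y)) * \<omega> (ph z' (Suc k))"
          by (simp only: char_add[symmetric])
        hence phase_eq: "\<omega> ((cs z' k - cs z' (Suc k)) * y) * W k z z' *
            (\<alpha> z' * \<omega> (- (cs z' k * (y - poly A (xs z' k)))) / sqrt n * \<omega> (ph z' k))
            = W k z z' * (\<alpha> z' * \<omega> (- (cs z' (Suc k) * y)) / sqrt n * \<omega> (ph z' (Suc k)))"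
          by (simp only: times_divide_eq_left times_divide_eq_right mult_ac)
        show "\<omega> ((cs z' k - cs z' (Suc k)) * y) * W k z z' *
            query A (state_after \<A> A k) (x - (xs z' (Suc k) - xs z' k), y, z')
            = W k z z' * amp (Suc k) x y z'"
        proof (cases "x = xs z' (Suc k)")
          case True
          have "x - (xs z' (Suc k) - xs z' k) = xs z' k"
            using True by simp
          thus ?thesis
            using True phase_eq by (simp only: query_eq amp_def if_True refl)
        qed (simp only: query_eq amp_def x_eq if_False mult_zero_right)
      qed
      finally show ?thesis .
    qed
    have state: "state_after \<A> A k (x, y, z) = amp k x y z" if "k \<le> q'" "z < N" for k x y z
      using that
    proof (induction k arbitrary: x y z)
      case 0
      thus ?case
        by (simp add: amp_def \<A>_def ph_def)
    next
      case (Suc k)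
      have "state_after \<A> A (Suc k) (x, y, z) = (\<Sum>z'<N. W k z z' * amp (Suc k) x y z')"
        using Suc by (intro step) auto
      also have "\<dots> = (\<Sum>z'<N. if z' = z then amp (Suc k) x y z else 0)"
        using Suc.prems by (intro sum.cong refl) (auto simp: W_def)
      finally show ?case
        using Suc.prems by simp
    qed
    obtain zA where zA: "zA < N" "g zA = A"
      using g A by (auto simp: bij_betw_def)
    have phase: "ph z q = dual_pairing d (g z) A" if "g z \<in> R" for z
    proof -
      have "dual_pairing d (g z) A = (\<Sum>k<q. C (g z) k * poly A (X (g z) k))"
        using A by (subst XC[OF that]) (simp add: dual_pairing_sum dual_pairing_smult dual_pairing_eval_vec P_def)
      thus ?thesis
        by (simp add: ph_def xs_def cs_def)
    qed
    \<comment> \<open>At the index of the true input the Fourier kernel cancels the accumulated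
      phases, so all \<open>\<rho>\<close> branches add up with the same amplitude.\<close>
    have final: "state_after \<A> A q (x, y, zA)
        = (if x = 0 then complex_of_real (sqrt \<rho> / (sqrt N * sqrt n)) else 0)" for x y
    proof -
      have "state_after \<A> A q (x, y, zA) = (\<Sum>z<N. W q' zA z * amp q x y z)"
        unfolding q by (intro step state) auto
      also have "\<dots> = (\<Sum>z<N. if g z \<in> R then
          (if x = 0 then complex_of_real (1 / (sqrt \<rho> * sqrt N * sqrt n)) else 0) else 0)"
      proof (intro sum.cong refl)
        fix z
        show "W q' zA z * amp q x y z = (if g z \<in> R then
          (if x = 0 then complex_of_real (1 / (sqrt \<rho> * sqrt N * sqrt n)) else 0) else 0)"
        proof (cases "g z \<in> R \<and> x = 0")
          case True
          have "cnj (\<omega> (dual_pairing d A (g z))) * \<omega> (dual_pairing d A (g z)) = 1"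
            using char_mult_cnj(2)[of "dual_pairing d A (g z)" 1] by simp
          thus ?thesis
            using True by (simp add: W_def amp_def xs_def cs_def \<alpha>_def phase zA
                dual_pairing_commute[of d "g z" A])
        qed (auto simp: amp_def xs_def \<alpha>_def)
      qed
      also have "\<dots> = (if x = 0 then complex_of_real (sqrt \<rho> / (sqrt N * sqrt n)) else 0)"
      proof -
        have "real \<rho> * (1 / (sqrt \<rho> * sqrt N * sqrt n)) = real \<rho> / sqrt \<rho> / (sqrt N * sqrt n)"
          by simp
        also have "\<dots> = sqrt \<rho> / (sqrt N * sqrt n)"
          by (simp only: real_div_sqrt of_nat_0_le_iff)
        finally have "complex_of_real (real \<rho> * (1 / (sqrt \<rho> * sqrt N * sqrt n)))
            = complex_of_real (sqrt \<rho> / (sqrt N * sqrt n))"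
          by (simp only:)
        hence "of_nat \<rho> * complex_of_real (1 / (sqrt \<rho> * sqrt N * sqrt n))
            = complex_of_real (sqrt \<rho> / (sqrt N * sqrt n))"
          by (simp only: of_real_mult of_real_of_nat_eq)
        thus ?thesis
          unfolding sum_\<alpha> by (cases "x = 0") (simp_all only: simp_thms if_True if_False mult_zero_right)
      qed
      finally show ?thesis .
    qed
    have "success_on d q \<A> A
        = (\<Sum>b\<in>basis N. if output \<A> b = coeff_list d A then (cmod (state_after \<A> A q b))\<^sup>2 else 0)"
      unfolding success_on_def by (simp add: sum.inter_filter workspace_eq)
    also have "\<dots> = (\<Sum>z<N. if z = zA then
        (\<Sum>y\<in>UNIV. \<Sum>x\<in>UNIV. (cmod (state_after \<A> A q (x, y, zA)))\<^sup>2) else 0)"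
    proof -
      have "coeff_list d (g z) = coeff_list d A \<longleftrightarrow> z = zA" if "z < N" for z
        using bij_betw_coeff_list[of d] gP[OF that] A g_eq[OF that zA(1)]
        by (auto simp: bij_betw_def inj_on_def P_def zA(2))
      thus ?thesis
        unfolding sum_basis by (intro sum.cong refl) (simp add: output_eq)
    qed
    also have "\<dots> = (\<Sum>y\<in>UNIV. \<Sum>x\<in>UNIV. (cmod (state_after \<A> A q (x, y, zA)))\<^sup>2)"
      using zA by simp
    also have "\<dots> = (\<Sum>y\<in>(UNIV :: 'a set). \<Sum>x\<in>(UNIV :: 'a set). if x = 0 then real \<rho> / (real N * real n) else 0)"
      by (intro sum.cong refl)
        (auto simp: final norm_divide norm_mult power_divide power_mult_distrib)
    also have "\<dots> = real \<rho> / real N"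
      using pos by (simp add: n_def)
    finally show ?thesis .
  qed
  have "success_probability d q \<A> = real \<rho> / real N"
    using pos by (simp add: success_probability_def success flip: P_def N_def)
  thus ?thesis
    using alg by (auto simp: \<rho>_def N_def R_def P_def)
qed

text \<open>Without queries there is no last unitary to invert the transform. Guessing the zero
  polynomial then attains the value, as \<open>reachable d 0\<close> is a singleton.\<close>

lemma ex_optimal_algorithm:
  "\<exists>\<A> :: 'a query_algorithm. is_query_algorithm q \<A> \<and> success_probability d q \<A>
    = real (card (reachable d q :: 'a poly set)) / real (card (polys_upto d :: 'a poly set))"
proof (cases q)
  case 0
  define \<A> :: "'a query_algorithm" where
    "\<A> = \<lparr>workspace = 1, initial = ket (0, 0, 0), unitaries = (\<lambda>_ _ _. 0),
      output = (\<lambda>_. coeff_list d 0)\<rparr>"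
  have ket: "(\<Sum>b\<in>(basis 1 :: 'a label set). (cmod (ket (0, 0, 0) b))\<^sup>2) = 1"
  proof -
    have "(\<Sum>b\<in>(basis 1 :: 'a label set). (cmod (ket (0, 0, 0) b))\<^sup>2)
        = (\<Sum>b\<in>basis 1. if b = (0 :: 'a, 0 :: 'a, 0) then 1 else 0 :: real)"
      by (intro sum.cong) (auto simp: ket_def)
    thus ?thesis
      by (simp add: basis_def)
  qed
  have "success_on d 0 \<A> A = (if A = 0 then 1 else 0)" if "A \<in> polys_upto d" for A
  proof -
    have "coeff_list d 0 = coeff_list d A \<longleftrightarrow> A = 0"
      using bij_betw_coeff_list[of d] that by (auto simp: bij_betw_def inj_on_def polys_upto_def)
    thus ?thesis
      using ket by (simp add: success_on_def \<A>_def)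
  qed
  hence "(\<Sum>A\<in>polys_upto d. success_on d 0 \<A> A)
      = (\<Sum>A\<in>(polys_upto d :: 'a poly set). if A = 0 then 1 else 0)"
    by (auto intro!: sum.cong)
  also have "\<dots> = 1"
    by (simp add: finite_polys_upto) (simp add: polys_upto_def)
  finally have "success_probability d 0 \<A> = 1 / real (card (polys_upto d :: 'a poly set))"
    by (simp add: success_probability_def)
  moreover have "is_query_algorithm 0 \<A>"
    using ket by (simp add: is_query_algorithm_def \<A>_def)
  ultimately show ?thesis
    using 0 by (auto simp: reachable_0)
qed (rule ex_optimal_algorithm_Suc)

end

lemma max_success_probability:
  "is_max_success_probability TYPE('a::{field,finite}) d q
    (real (card (reachable d q :: 'a poly set)) / real CARD('a) ^ (d + 1))"
proof -
  obtain \<omega> :: "'a \<Rightarrow> complex" where "additive_character \<omega>"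
    using ex_additive_character by blast
  then interpret additive_character \<omega> .
  show ?thesis
    using ex_optimal_algorithm[of q d] success_probability_le[of q _ d]
    unfolding is_max_success_probability_def by (simp add: card_polys_upto)
qed

section \<open>Counting reachable vectors\<close>

lemma card_functions_on:
  fixes S :: "'a::finite set" and T :: "'b::zero set"
  shows "card {w. (\<forall>s\<in>S. w s \<in> T) \<and> (\<forall>s. s \<notin> S \<longrightarrow> w s = 0)} = card T ^ card S"
proof -
  have "bij_betw (\<lambda>w. restrict w S) {w. (\<forall>s\<in>S. w s \<in> T) \<and> (\<forall>s. s \<notin> S \<longrightarrow> w s = 0)}
      (S \<rightarrow>\<^sub>E T)"
    by (rule bij_betw_byWitness[where f' = "\<lambda>f s. if s \<in> S then f s else 0"])
      (auto simp: fun_eq_iff PiE_def extensional_def)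
  thus ?thesis
    by (simp add: bij_betw_same_card card_PiE)
qed

lemma card_supp_eq:
  "card {w :: 'a \<Rightarrow> 'a::{field,finite}. supp w = S} = (CARD('a) - 1) ^ card S"
proof -
  have "{w :: 'a \<Rightarrow> 'a. supp w = S} = {w. (\<forall>s\<in>S. w s \<in> UNIV - {0}) \<and> (\<forall>s. s \<notin> S \<longrightarrow> w s = 0)}"
    by (auto simp: supp_def)
  thus ?thesis
    by (simp only: card_functions_on) (simp add: card_Diff_singleton)
qed

lemma card_supp_subset:
  "card {w :: 'a \<Rightarrow> 'a::{field,finite}. supp w \<subseteq> S} = CARD('a) ^ card S"
proof -
  have "{w :: 'a \<Rightarrow> 'a. supp w \<subseteq> S} = {w. (\<forall>s\<in>S. w s \<in> UNIV) \<and> (\<forall>s. s \<notin> S \<longrightarrow> w s = 0)}"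
    by (auto simp: supp_def)
  thus ?thesis
    by (simp only: card_functions_on)
qed

lemma card_subsets_UNIV: "card {S :: 'a::finite set. card S = k} = CARD('a) choose k"
  using n_subsets[of "UNIV :: 'a set" k] by simp

lemma card_card_supp_eq:
  "card {w :: 'a \<Rightarrow> 'a::{field,finite}. card (supp w) = k}
    = (CARD('a) choose k) * (CARD('a) - 1) ^ k"
proof -
  have "{w :: 'a \<Rightarrow> 'a. card (supp w) = k} = (\<Union>S\<in>{S. card S = k}. {w. supp w = S})"
    by auto
  also have "card \<dots> = (\<Sum>S\<in>{S :: 'a set. card S = k}. card {w :: 'a \<Rightarrow> 'a. supp w = S})"
    by (rule card_UN_disjoint) auto
  finally show ?thesis
    by (simp add: card_supp_eq card_subsets_UNIV)
qed

text \<open>Each of the \<open>q\<close> terms is given by a coefficient and a point, hence by two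
  field elements.\<close>

lemma card_reachable_le_power:
  "card (reachable d q :: 'a::{field,finite} poly set) \<le> CARD('a) ^ (2 * q)"
proof -
  define h :: "(nat \<Rightarrow> 'a \<times> 'a) \<Rightarrow> 'a poly"
    where "h f = (\<Sum>k<q. smult (fst (f k)) (eval_vec d (snd (f k))))" for f
  have "reachable d q \<subseteq> h ` ({..<q} \<rightarrow>\<^sub>E UNIV)"
  proof
    fix r :: "'a poly"
    assume "r \<in> reachable d q"
    then obtain x c where "r = (\<Sum>k<q. smult (c k) (eval_vec d (x k)))"
      by (rule reachable_enum)
    hence "r = h (\<lambda>k\<in>{..<q}. (c k, x k))"
      by (simp add: h_def)
    thus "r \<in> h ` ({..<q} \<rightarrow>\<^sub>E UNIV)"
      by (rule image_eqI[where f = h]) simp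
  qed
  moreover have fin: "finite ({..<q} \<rightarrow>\<^sub>E (UNIV :: ('a \<times> 'a) set))"
    by (intro finite_PiE) auto
  ultimately have "card (reachable d q :: 'a poly set) \<le> card (h ` ({..<q} \<rightarrow>\<^sub>E UNIV))"
    by (intro card_mono finite_imageI)
  also have "\<dots> \<le> card ({..<q} \<rightarrow>\<^sub>E (UNIV :: ('a \<times> 'a) set))"
    by (rule card_image_le[OF fin])
  also have "\<dots> = (CARD('a) ^ 2) ^ q"
    by (simp add: card_PiE power2_eq_square)
  finally show ?thesis
    by (simp only: power_mult)
qed

text \<open>If the field has at least \<open>q\<close> points, every smaller support extends to a
  set of exactly \<open>q\<close> points.\<close>

lemma card_reachable_le_choose:
  assumes "q \<le> CARD('a)"
  shows "card (reachable d q :: 'a::{field,finite} poly set) \<le> (CARD('a) choose q) * CARD('a) ^ q"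
proof -
  have "{w :: 'a \<Rightarrow> 'a. card (supp w) \<le> q} \<subseteq> (\<Union>S\<in>{S. card S = q}. {w. supp w \<subseteq> S})"
  proof
    fix w :: "'a \<Rightarrow> 'a"
    assume "w \<in> {w. card (supp w) \<le> q}"
    then obtain S where "supp w \<subseteq> S" "card S = q"
      using exists_subset_between[of "supp w" q UNIV] assms by auto
    thus "w \<in> (\<Union>S\<in>{S. card S = q}. {w. supp w \<subseteq> S})"
      by blast
  qed
  hence "card {w :: 'a \<Rightarrow> 'a. card (supp w) \<le> q}
      \<le> card (\<Union>S\<in>{S :: 'a set. card S = q}. {w :: 'a \<Rightarrow> 'a. supp w \<subseteq> S})"
    by (intro card_mono) auto
  also have "\<dots> \<le> (\<Sum>S\<in>{S :: 'a set. card S = q}. card {w :: 'a \<Rightarrow> 'a. supp w \<subseteq> S})"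
    by (rule card_UN_le) auto
  also have "\<dots> = (CARD('a) choose q) * CARD('a) ^ q"
    by (simp add: card_supp_subset card_subsets_UNIV)
  finally have *: "card {w :: 'a \<Rightarrow> 'a. card (supp w) \<le> q} \<le> (CARD('a) choose q) * CARD('a) ^ q" .
  show ?thesis
    unfolding reachable_def by (rule order.trans[OF card_image_le *]) simp
qed

lemma combine_eqD:
  fixes v w :: "'a::{field,finite} \<Rightarrow> 'a"
  assumes "combine d v = combine d w" "card (supp v \<union> supp w) \<le> d + 1"
  shows "v = w"
proof -
  have "(\<lambda>s. v s - w s) = (\<lambda>_. 0)"
    by (rule combine_eq_0D[of d _ "supp v \<union> supp w"])
      (use assms in \<open>auto simp: combine_diff supp_def\<close>)
  thus ?thesis
    by (auto simp: fun_eq_iff)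
qed

text \<open>Two supports of size \<open>k\<close> together have at most \<open>d + 1\<close> points,
  so linear independence makes \<open>combine d\<close> injective here.\<close>

lemma card_reachable_ge_choose:
  assumes "2 * k \<le> d + 1"
  shows "(CARD('a) choose k) * (CARD('a) - 1) ^ k \<le> card (reachable d k :: 'a::{field,finite} poly set)"
proof -
  have "inj_on (combine d) {w :: 'a \<Rightarrow> 'a. card (supp w) = k}"
  proof (rule inj_onI)
    fix v w :: "'a \<Rightarrow> 'a"
    assume *: "v \<in> {w. card (supp w) = k}" "w \<in> {w. card (supp w) = k}" "combine d v = combine d w"
    have "card (supp v \<union> supp w) \<le> d + 1"
      using card_Un_le[of "supp v" "supp w"] * assms by auto
    thus "v = w"
      using * combine_eqD by blast
  qed
  moreover have "combine d ` {w :: 'a \<Rightarrow> 'a. card (supp w) = k} \<subseteq> reachable d k"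
    by (auto simp: reachable_def)
  ultimately show ?thesis
    unfolding card_card_supp_eq[symmetric] by (rule card_inj_on_le) (rule finite_reachable)
qed

text \<open>Two combinations with the same value and different supports are determined by the \<open>r\<close>
  coefficients of the first one on a set \<open>Q\<close> with \<open>S \<inter> T \<subseteq> Q \<subseteq> S\<close>: two such pairs agreeing there
  differ by a relation among \<open>2 * k - r = d + 1\<close> points.\<close>

lemma card_collisions_le:
  fixes S T :: "'a::{field,finite} set"
  assumes ST: "S \<noteq> T" "card S = k" "card T = k" and r: "r + d + 1 = 2 * k" "r \<le> k"
  shows "card {(v, w). supp v = S \<and> supp w = T \<and> combine d v = combine d w} \<le> (CARD('a) - 1) ^ r"
proof (cases "card (S \<inter> T) \<ge> r")
  case True
  \<comment> \<open>A large intersection leaves at most \<open>2 * k - r = d + 1\<close> points in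
    the union, so equal values would force equal supports.\<close>
  have "card (S \<union> T) \<le> d + 1"
    using card_Un_Int[of S T] ST r True by auto
  hence "{(v, w). supp v = S \<and> supp w = T \<and> combine d v = combine d w} = {}"
    using combine_eqD ST(1) by blast
  thus ?thesis
    by (simp only: card.empty zero_le)
next
  case False
  then obtain Q where Q: "S \<inter> T \<subseteq> Q" "Q \<subseteq> S" "card Q = r"
    using exists_subset_between[of "S \<inter> T" r S] ST r by auto
  have card_U: "card ((S - Q) \<union> T) \<le> d + 1"
    using card_Un_le[of "S - Q" T] card_Diff_subset[of Q S] Q ST r by auto
  define h where "h = (\<lambda>(v, w :: 'a \<Rightarrow> 'a). \<lambda>s. if s \<in> Q then v s else (0 :: 'a))"
  have "inj_on h {(v, w). supp v = S \<and> supp w = T \<and> combine d v = combine d w}"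
  proof (rule inj_onI, safe)
    fix v w v' w' :: "'a \<Rightarrow> 'a"
    assume hyps: "h (v, w) = h (v', w')" "S = supp v" "T = supp w" "supp v' = supp v"
      "supp w' = supp w" "combine d v = combine d w" "combine d v' = combine d w'"
    have Q_eq: "v s = v' s" if "s \<in> Q" for s
      using fun_cong[OF hyps(1), of s] that by (simp add: h_def)
    have S_eq: "v s = 0 \<and> v' s = 0" if "s \<notin> S" for s
    proof -
      have "s \<notin> supp v" "s \<notin> supp v'"
        using that hyps by auto
      thus ?thesis
        by (simp add: supp_def)
    qed
    have T_eq: "w s = 0 \<and> w' s = 0" if "s \<notin> T" for s
    proof -
      have "s \<notin> supp w" "s \<notin> supp w'"
        using that hyps by auto
      thus ?thesis
        by (simp add: supp_def)
    qed
    have "(\<lambda>s. (v s - v' s) - (w s - w' s)) = (\<lambda>_. 0)"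
    proof (rule combine_eq_0D)
      show "combine d (\<lambda>s. (v s - v' s) - (w s - w' s)) = 0"
        using hyps by (simp add: combine_diff)
      show "supp (\<lambda>s. (v s - v' s) - (w s - w' s)) \<subseteq> (S - Q) \<union> T"
        using Q_eq S_eq T_eq by (fastforce simp: supp_def)
    qed (rule card_U)
    hence eq: "v s - v' s = w s - w' s" for s
      by (auto simp: fun_eq_iff)
    \<comment> \<open>On \<open>T\<close>, a point of \<open>S\<close> lies in \<open>Q\<close>,
      where both functions agree; off \<open>T\<close> the right-hand side of \<open>eq\<close> is
      zero.\<close>
    have v: "v s = v' s" for s
    proof (cases "s \<in> T")
      case True
      thus ?thesis
        using Q_eq[of s] Q(1) S_eq[of s] by (cases "s \<in> S") auto
    next
      case False
      thus ?thesis
        using eq[of s] T_eq[of s] by simp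
    qed
    thus "v = v'"
      by blast
    show "w = w'"
      using eq v by (auto simp: fun_eq_iff)
  qed
  moreover have "h ` {(v, w). supp v = S \<and> supp w = T \<and> combine d v = combine d w} \<subseteq> {f. supp f = Q}"
    using Q(2) by (auto simp: h_def supp_def split: if_splits)
  ultimately have "card {(v, w). supp v = S \<and> supp w = T \<and> combine d v = combine d w}
      \<le> card {f :: 'a \<Rightarrow> 'a. supp f = Q}"
    by (rule card_inj_on_le) simp
  thus ?thesis
    by (simp add: card_supp_eq Q)
qed

text \<open>Cauchy-Schwarz for the fibre sizes \<open>m y\<close>, whose sum is
  \<open>card A\<close> and whose squares count the collisions.\<close>

lemma card_square_le_image_times_collisions:
  assumes "finite A"
  shows "(card A)\<^sup>2 \<le> card (f ` A) * card {(a, b) \<in> A \<times> A. f a = f b}"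
proof -
  define m where "m y = card {a \<in> A. f a = y}" for y
  have "card A = (\<Sum>y\<in>f ` A. m y)"
    using sum.image_gen[OF assms, of "\<lambda>_. 1 :: nat" f] by (simp add: m_def)
  moreover have "card {(a, b) \<in> A \<times> A. f a = f b} = (\<Sum>y\<in>f ` A. (m y)\<^sup>2)"
  proof -
    have "{(a, b) \<in> A \<times> A. f a = f b} = Sigma A (\<lambda>a. {b \<in> A. f b = f a})"
      by auto
    hence "card {(a, b) \<in> A \<times> A. f a = f b} = (\<Sum>a\<in>A. m (f a))"
      using assms by (simp add: m_def)
    also have "\<dots> = (\<Sum>y\<in>f ` A. \<Sum>a\<in>{a \<in> A. f a = y}. m (f a))"
      by (rule sum.image_gen[OF assms])
    also have "\<dots> = (\<Sum>y\<in>f ` A. (m y)\<^sup>2)"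
      by (intro sum.cong refl) (simp add: m_def power2_eq_square)
    finally show ?thesis .
  qed
  moreover have "(\<Sum>y\<in>f ` A. 1 * real (m y))\<^sup>2 \<le> (\<Sum>y\<in>f ` A. 1\<^sup>2) * (\<Sum>y\<in>f ` A. (real (m y))\<^sup>2)"
    by (rule Cauchy_Schwarz_ineq_sum)
  hence "real ((\<Sum>y\<in>f ` A. m y)\<^sup>2) \<le> real (card (f ` A) * (\<Sum>y\<in>f ` A. (m y)\<^sup>2))"
    by simp
  ultimately show ?thesis
    by (simp only: of_nat_le_iff)
qed

text \<open>Among functions with support of size \<open>k\<close>, there are
  \<open>C * m ^ k\<close> trivial collisions and at most \<open>C * C * m ^ r\<close> between
  different supports. The second-moment inequality is then divided by
  \<open>C * m ^ r\<close>.\<close>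

lemma card_reachable_collision_bound:
  assumes r: "r + d + 1 = 2 * k" "r \<le> k" and k: "k \<le> CARD('a)"
  shows "(CARD('a) choose k) * (CARD('a) - 1) ^ (d + 1)
    \<le> card (reachable d k :: 'a::{field,finite} poly set)
      * ((CARD('a) - 1) ^ (k - r) + (CARD('a) choose k))"
proof -
  define m where "m = CARD('a) - 1"
  define C where "C = CARD('a) choose k"
  define \<W> where "\<W> = {w :: 'a \<Rightarrow> 'a. card (supp w) = k}"
  define \<S> where "\<S> = {S :: 'a set. card S = k}"
  have "CARD('a) \<noteq> 1"
    by (metis card_1_singletonE UNIV_I singletonD zero_neq_one)
  hence m: "m > 0"
    unfolding m_def using zero_less_card_finite[where ?'a = 'a] by linarith
  have C: "C > 0"
    using k by (simp add: C_def)
  have card_W: "card \<W> = C * m ^ k"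
    by (simp add: \<W>_def card_card_supp_eq C_def m_def)
  define coll where "coll = (\<lambda>(S :: 'a set, T).
    {(v :: 'a \<Rightarrow> 'a, w :: 'a \<Rightarrow> 'a). supp v = S \<and> supp w = T \<and> combine d v = combine d w})"
  have "{(v, w) \<in> \<W> \<times> \<W>. combine d v = combine d w}
      \<subseteq> (\<lambda>v. (v, v)) ` \<W> \<union> (\<Union>p\<in>{(S, T) \<in> \<S> \<times> \<S>. S \<noteq> T}. coll p)"
  proof safe
    fix v w
    assume vw: "v \<in> \<W>" "w \<in> \<W>" "combine d v = combine d w"
      and *: "(v, w) \<notin> (\<Union>p\<in>{(S, T) \<in> \<S> \<times> \<S>. S \<noteq> T}. coll p)"
    have "supp v = supp w"
      using vw * by (auto simp: coll_def \<W>_def \<S>_def)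
    \<comment> \<open>The union has only \<open>k\<close> points, and \<open>k \<le> d + 1\<close>
      follows from \<open>r\<close>.\<close>
    hence "card (supp v \<union> supp w) \<le> d + 1"
      using vw r by (simp add: \<W>_def)
    hence "v = w"
      using combine_eqD vw(3) by blast
    thus "(v, w) \<in> (\<lambda>v. (v, v)) ` \<W>"
      using vw by auto
  qed
  hence "card {(v, w) \<in> \<W> \<times> \<W>. combine d v = combine d w}
      \<le> card ((\<lambda>v. (v, v)) ` \<W> \<union> (\<Union>p\<in>{(S, T) \<in> \<S> \<times> \<S>. S \<noteq> T}. coll p))"
    by (intro card_mono) auto
  also have "\<dots> \<le> card ((\<lambda>v. (v, v)) ` \<W>) + card (\<Union>p\<in>{(S, T) \<in> \<S> \<times> \<S>. S \<noteq> T}. coll p)"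
    by (rule card_Un_le)
  also have "\<dots> \<le> card \<W> + (\<Sum>p\<in>{(S, T) \<in> \<S> \<times> \<S>. S \<noteq> T}. card (coll p))"
    by (intro add_mono card_image_le card_UN_le) auto
  also have "\<dots> \<le> card \<W> + of_nat (card {(S, T) \<in> \<S> \<times> \<S>. S \<noteq> T}) * m ^ r"
  proof (rule add_left_mono, rule sum_bounded_above)
    fix p
    assume "p \<in> {(S, T) \<in> \<S> \<times> \<S>. S \<noteq> T}"
    then obtain S T where "p = (S, T)" "S \<noteq> T" "card S = k" "card T = k"
      by (auto simp: \<S>_def)
    thus "card (coll p) \<le> m ^ r"
      using card_collisions_le[OF _ _ _ r, of S T] by (simp add: coll_def m_def)
  qed
  also have "card {(S, T) \<in> \<S> \<times> \<S>. S \<noteq> T} \<le> card (\<S> \<times> \<S>)"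
    by (intro card_mono) auto
  hence "card \<W> + of_nat (card {(S, T) \<in> \<S> \<times> \<S>. S \<noteq> T}) * m ^ r \<le> C * m ^ k + C * C * m ^ r"
    by (simp add: card_W card_cartesian_product \<S>_def card_subsets_UNIV C_def del: mult_le_cancel2)
  finally have "card {(v, w) \<in> \<W> \<times> \<W>. combine d v = combine d w} \<le> C * m ^ k + C * C * m ^ r" .
  hence "(card \<W>)\<^sup>2 \<le> card (combine d ` \<W>) * (C * m ^ k + C * C * m ^ r)"
    by (rule order.trans[OF card_square_le_image_times_collisions[OF finite] mult_le_mono2])
  also have "card (combine d ` \<W>) \<le> card (reachable d k :: 'a poly set)"
    by (intro card_mono finite_reachable) (auto simp: reachable_def \<W>_def)
  finally have "(C * m ^ k)\<^sup>2 \<le> card (reachable d k :: 'a poly set) * (C * m ^ k + C * C * m ^ r)"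
    by (simp add: card_W)
  also have "(C * m ^ k)\<^sup>2 = (C * m ^ r) * (C * m ^ (d + 1))"
  proof -
    have "(C * m ^ k)\<^sup>2 = C * C * m ^ (2 * k)"
      by (simp only: power_mult_distrib power_mult[symmetric] mult.commute[of k 2] power2_eq_square[of C])
    also have "m ^ (2 * k) = m ^ r * m ^ (d + 1)"
      unfolding r(1)[symmetric] by (simp only: power_add[symmetric] add.assoc)
    finally show ?thesis
      by (simp only: mult_ac)
  qed
  also have "C * m ^ k + C * C * m ^ r = (C * m ^ r) * (m ^ (k - r) + C)"
  proof -
    have "m ^ k = m ^ r * m ^ (k - r)"
      using r(2) by (simp flip: power_add)
    thus ?thesis
      by (simp only: distrib_left mult_ac)
  qed
  finally have "(C * m ^ r) * (C * m ^ (d + 1))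
      \<le> (C * m ^ r) * (card (reachable d k :: 'a poly set) * (m ^ (k - r) + C))"
    by (simp only: mult.left_commute)
  moreover have "0 < C * m ^ r"
    using C m by simp
  ultimately show ?thesis
    unfolding m_def C_def by (simp only: nat_mult_le_cancel1)
qed

section \<open>The three regimes\<close>

lemma one_minus_mult_ge:
  fixes a b c :: real
  assumes "1 - a \<ge> 0" "c \<ge> 1 - b" "a \<ge> 0" "b \<ge> 0"
  shows "1 - (a + b) \<le> (1 - a) * c"
proof -
  have "1 - (a + b) \<le> (1 - a) * (1 - b)"
    using assms by (simp add: algebra_simps)
  also have "\<dots> \<le> (1 - a) * c"
    using assms by (intro mult_left_mono)
  finally show ?thesis .
qed

text \<open>The right-hand side is the falling factorial, that is \<open>n ^ k\<close> times the
  product of the factors \<open>1 - i / n\<close> for \<open>i < k\<close>; the subtracted fractions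
  sum to \<open>(k choose 2) / n\<close>.\<close>

lemma fact_times_choose_ge:
  assumes "k \<le> n" "n > 0"
  shows "real n ^ k * (1 - real (k choose 2) / real n) \<le> fact k * real (n choose k)"
  using assms(1)
proof (induction k)
  case (Suc k)
  have absorb: "fact (Suc k) * real (n choose Suc k) = (real n - real k) * (fact k * real (n choose k))"
  proof -
    have "Suc k * (n choose Suc k) = (n - k) * (n choose k)"
      using binomial_absorb_comp[of n k] binomial_absorption[of k n] Suc.prems
      by (metis Suc_times_binomial_add add_diff_inverse_nat diff_Suc_Suc le_add_diff_inverse mult.commute not_less)
    hence "real (Suc k) * real (n choose Suc k) = real (n - k) * real (n choose k)"
      by (simp only: flip: of_nat_mult)
    moreover have "fact (Suc k) * real (n choose Suc k) = fact k * (real (Suc k) * real (n choose Suc k))"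
      by simp
    ultimately show ?thesis
      using Suc.prems by (simp only: of_nat_diff mult.left_commute Suc_leD)
  qed
  have "real n ^ Suc k * (1 - real (Suc k choose 2) / real n)
      \<le> real n ^ Suc k * ((1 - real k / real n) * (1 - real (k choose 2) / real n))"
  proof (intro mult_left_mono)
    have "real (Suc k choose 2) / real n = real k / real n + real (k choose 2) / real n"
      by (simp add: numeral_2_eq_2 add_divide_distrib)
    thus "1 - real (Suc k choose 2) / real n \<le> (1 - real k / real n) * (1 - real (k choose 2) / real n)"
      using Suc.prems by (simp only:) (intro one_minus_mult_ge; simp)
  qed simp
  also have "\<dots> = (real n - real k) * (real n ^ k * (1 - real (k choose 2) / real n))"
    using assms(2) by (simp add: field_simps)
  also have "\<dots> \<le> (real n - real k) * (fact k * real (n choose k))"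
    using Suc by (intro mult_left_mono) auto
  finally show ?case
    by (simp only: absorb)
qed simp

lemma Bernoulli_one_minus:
  assumes "n > 0"
  shows "1 - real m / real n \<le> (1 - 1 / real n) ^ m"
  using Bernoulli_inequality[of "- (1 / real n)" m] assms by simp

text \<open>Choosing distinct points costs \<open>(q choose 2) / n\<close> and nonzero coefficients
  cost \<open>q / n\<close>, together \<open>((q + 1) choose 2) / n\<close>. If this is at least 1,
  the bound is trivial.\<close>

lemma reachable_fraction_ge_choose:
  assumes "2 * q = d + 1"
  shows "1 / fact q * (1 - real ((q + 1) choose 2) * (1 / real CARD('a)))
    \<le> real (card (reachable d q :: 'a::{field,finite} poly set)) / real CARD('a) ^ (d + 1)"
proof (cases "(q + 1) choose 2 < CARD('a)")
  case False
  hence "1 / fact q * (1 - real ((q + 1) choose 2) * (1 / real CARD('a))) \<le> (0 :: real)"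
    by (intro mult_nonneg_nonpos) (auto simp: field_simps)
  also have "\<dots> \<le> real (card (reachable d q :: 'a poly set)) / real CARD('a) ^ (d + 1)"
    by simp
  finally show ?thesis .
next
  case True
  define n where "n = CARD('a)"
  have n: "n > 0"
    by (simp add: n_def)
  have choose_Suc: "(q + 1) choose 2 = q + (q choose 2)"
    by (simp add: numeral_2_eq_2)
  hence qn: "q + (q choose 2) < n"
    using True by (simp add: n_def)
  have "1 - (real (q choose 2) / real n + real q / real n)
      \<le> (1 - real (q choose 2) / real n) * (1 - 1 / real n) ^ q"
    using qn n Bernoulli_one_minus[OF n, of q] by (intro one_minus_mult_ge) auto
  hence "1 - real ((q + 1) choose 2) * (1 / real n)
      \<le> (1 - real (q choose 2) / real n) * (1 - 1 / real n) ^ q"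
    unfolding choose_Suc by (simp add: add_divide_distrib add.commute)
  also have "\<dots> \<le> (fact q * real (n choose q) / real n ^ q) * (1 - 1 / real n) ^ q"
    using fact_times_choose_ge[of q n] qn n by (intro mult_right_mono) (auto simp: field_simps)
  also have "\<dots> = fact q * (real ((n choose q) * (n - 1) ^ q) / real n ^ (d + 1))"
  proof -
    have "1 - 1 / real n = real (n - 1) / real n"
      using n by (simp add: field_simps of_nat_diff)
    moreover have "real n ^ (d + 1) = real n ^ q * real n ^ q"
      unfolding assms[symmetric] by (simp add: mult_2 power_add)
    ultimately show ?thesis
      by (simp add: power_divide)
  qed
  also have "\<dots> \<le> fact q * (real (card (reachable d q :: 'a poly set)) / real n ^ (d + 1))"
    using card_reachable_ge_choose[of q d, where ?'a = 'a] assms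
    by (intro mult_left_mono divide_right_mono) (auto simp: n_def simp flip: of_nat_mult of_nat_power)
  finally show ?thesis
    by (simp add: n_def field_simps)
qed

lemma reachable_fraction_le_fact:
  assumes "2 * q = d + 1" "q \<le> CARD('a)"
  shows "real (card (reachable d q :: 'a::{field,finite} poly set)) / real CARD('a) ^ (d + 1) \<le> 1 / fact q"
proof -
  define n where "n = CARD('a)"
  have n: "n > 0"
    by (simp add: n_def)
  have "fact q * (n choose q) \<le> n ^ q"
    using binomial_fact_lemma[of q n] fact_div_fact_le_pow[of q n] assms(2)
    by (simp add: n_def) (metis fact_nonzero mult.assoc mult.commute nonzero_mult_div_cancel_right)
  have "fact q * card (reachable d q :: 'a poly set) \<le> fact q * ((n choose q) * n ^ q)"
    unfolding n_def by (intro mult_left_mono card_reachable_le_choose assms) auto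
  also have "\<dots> \<le> n ^ q * n ^ q"
    using \<open>fact q * (n choose q) \<le> n ^ q\<close> unfolding mult.assoc[symmetric] by (rule mult_right_mono) simp
  also have "\<dots> = n ^ (d + 1)"
    unfolding assms(1)[symmetric] by (simp add: mult_2 power_add)
  finally have "real (fact q * card (reachable d q :: 'a poly set)) \<le> real (n ^ (d + 1))"
    by (simp only: of_nat_le_iff)
  thus ?thesis
    using n unfolding n_def by (simp add: field_simps)
qed

lemma reachable_fraction_le_inverse:
  assumes "2 * q \<le> d"
  shows "real (card (reachable d q :: 'a::{field,finite} poly set)) / real CARD('a) ^ (d + 1)
    \<le> 1 / real CARD('a)"
proof -
  have "card (reachable d q :: 'a poly set) \<le> CARD('a) ^ (2 * q)"
    by (rule card_reachable_le_power)
  also have "\<dots> \<le> CARD('a) ^ d"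
    using assms by (intro power_increasing) auto
  finally have "real (card (reachable d q :: 'a poly set)) \<le> real CARD('a) ^ d"
    by (simp flip: of_nat_power)
  thus ?thesis
    by (simp add: field_simps)
qed

text \<open>\<open>g\<close> stands for the factorial of \<open>d / 2 + 1\<close>, and
  \<open>r\<close> is 1 or 2 according to the parity of \<open>d\<close>. The collision bound loses
  a factor \<open>1 - g / n\<close>, and replacing \<open>n - 1\<close> by \<open>n\<close> in the
  power loses \<open>(d + 1) / n\<close> by Bernoulli.\<close>

lemma reachable_fraction_ge:
  fixes g :: real
  assumes r: "r + d + 1 = 2 * k" "1 \<le> r" "r \<le> k"
    and g: "real (k choose 2) \<le> g"
    and g_fact: "k \<le> CARD('a) \<Longrightarrow> fact k \<le> g * real CARD('a) ^ (r - 1)"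
  shows "1 - (g + real d + 1) / real CARD('a)
    \<le> real (card (reachable d k :: 'a::{field,finite} poly set)) / real CARD('a) ^ (d + 1)"
proof (cases "g + real d + 1 \<le> real CARD('a)")
  case False
  hence "1 - (g + real d + 1) / real CARD('a) \<le> 0"
    by (simp add: field_simps)
  also have "\<dots> \<le> real (card (reachable d k :: 'a poly set)) / real CARD('a) ^ (d + 1)"
    by simp
  finally show ?thesis .
next
  case True
  define n where "n = CARD('a)"
  define b where "b = real (k choose 2)"
  define C where "C = real (n choose k)"
  define \<rho> where "\<rho> = real (card (reachable d k :: 'a poly set))"
  have n: "n > 0"
    by (simp add: n_def)
  \<comment> \<open>In this case \<open>k \<le> n\<close>, because
    \<open>k \<le> 2 * k - r = d + 1\<close>.\<close>
  have gn: "g \<ge> 0" "g \<le> real n" and kn: "k \<le> n"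
    using g True r by (auto simp: n_def)
  have m: "real (n - 1) = real n - 1"
    using n by (simp add: of_nat_diff)
  \<comment> \<open>This rearranges the claim that \<open>C / (m ^ (k - r) + C)\<close> is at least
    \<open>1 - g / n\<close>, with \<open>m = n - 1\<close>.\<close>
  have le_C: "(1 - g / real n) * real (n - 1) ^ (k - r) \<le> C * (g / real n)"
  proof -
    have "(1 - g / real n) * real (n - 1) ^ (k - r) \<le> (1 - b / real n) * real n ^ (k - r)"
      using g gn n by (intro mult_mono power_mono) (auto simp: b_def field_simps)
    also have "\<dots> \<le> (1 - b / real n) * real n ^ (k - r) * (g * real n ^ (r - 1) / fact k)"
    proof -
      have "1 \<le> g * real n ^ (r - 1) / fact k"
        using g_fact kn by (simp add: n_def)
      moreover have "0 \<le> (1 - b / real n) * real n ^ (k - r)"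
        using g gn n by (simp add: b_def)
      ultimately show ?thesis
        by (metis mult.right_neutral mult_left_mono)
    qed
    also have "\<dots> = (real n ^ k * (1 - b / real n)) * (g / real n / fact k)"
    proof -
      have "k = (k - r) + (r - 1) + 1"
        using r by simp
      hence "real n ^ k = real n ^ (k - r) * real n ^ (r - 1) * real n"
        by (metis power_add power_one_right)
      thus ?thesis
        using n by simp
    qed
    also have "\<dots> \<le> (fact k * C) * (g / real n / fact k)"
      unfolding b_def C_def using gn by (intro mult_right_mono fact_times_choose_ge kn n) simp
    finally show ?thesis
      by simp
  qed
  have C: "C > 0"
    using kn by (simp add: C_def)
  have "C * real (n - 1) ^ (d + 1) \<le> \<rho> * (real (n - 1) ^ (k - r) + C)"
    using card_reachable_collision_bound[OF r(1,3) kn[unfolded n_def]]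
    unfolding C_def \<rho>_def n_def
    by (simp only: flip: of_nat_power of_nat_add of_nat_mult of_nat_le_iff[where ?'a = real])
  hence "(1 - g / real n) * (C * real (n - 1) ^ (d + 1))
      \<le> (1 - g / real n) * (\<rho> * (real (n - 1) ^ (k - r) + C))"
    using gn n by (intro mult_left_mono) auto
  also have "\<dots> = \<rho> * ((1 - g / real n) * real (n - 1) ^ (k - r) + (1 - g / real n) * C)"
    by (simp add: algebra_simps)
  also have "\<dots> \<le> \<rho> * (C * (g / real n) + (1 - g / real n) * C)"
    using le_C by (intro mult_left_mono add_right_mono) (auto simp: \<rho>_def)
  also have "\<dots> = C * \<rho>"
    by (simp add: algebra_simps)
  finally have "C * ((1 - g / real n) * real (n - 1) ^ (d + 1)) \<le> C * \<rho>"
    by (simp only: mult.left_commute)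
  hence \<rho>_ge: "(1 - g / real n) * real (n - 1) ^ (d + 1) \<le> \<rho>"
    using C by simp
  have "1 - (g / real n + real (d + 1) / real n) \<le> (1 - g / real n) * (1 - 1 / real n) ^ (d + 1)"
    using gn n Bernoulli_one_minus[OF n, of "d + 1"] by (intro one_minus_mult_ge) auto
  also have "\<dots> = (1 - g / real n) * real (n - 1) ^ (d + 1) / real n ^ (d + 1)"
  proof -
    have "1 - 1 / real n = real (n - 1) / real n"
      using n by (simp add: m field_simps)
    thus ?thesis
      by (simp add: power_divide)
  qed
  also have "\<dots> \<le> \<rho> / real n ^ (d + 1)"
    by (intro divide_right_mono \<rho>_ge) simp
  finally show ?thesis
    by (simp add: \<rho>_def n_def add_divide_distrib add.assoc)
qed

lemma choose_two_le_fact: "real (k choose 2) \<le> fact k"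
proof (cases "2 \<le> k")
  case True
  have "(k choose 2) * 1 \<le> (k choose 2) * (fact 2 * fact (k - 2))"
    by (intro mult_le_mono2) (simp add: Suc_leI)
  also have "\<dots> = fact k"
    using binomial_fact_lemma[OF True] by (simp add: mult_ac)
  finally have "real (k choose 2) \<le> real (fact k)"
    by (simp only: of_nat_le_iff mult_1_right)
  thus ?thesis
    by simp
qed (simp add: binomial_eq_0)

text \<open>For \<open>d = 2 * j + 1\<close> the factorial of \<open>d / 2 + 1\<close> is this Gamma
  value, and \<open>k = j + 2\<close>. The two bounds supply the hypotheses on \<open>g\<close> in
  \<open>reachable_fraction_ge\<close>.\<close>

lemma Gamma_half_integer_ge:
  "fact (Suc j) \<le> Gamma (real j + 5 / 2)" (is "?fact j")
  "real (Suc (Suc j) choose 2) \<le> Gamma (real j + 5 / 2)" (is "?choose j")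
proof -
  have Gamma_rec: "Gamma (x + 1) = x * Gamma x" if "x > 0" for x :: real
    using that by (intro Gamma_plus1) (auto elim!: nonpos_Ints_cases)
  \<comment> \<open>The constant gives \<open>Gamma (5 / 2) \<ge> 6 / 5\<close>, hence
    \<open>Gamma (7 / 2) \<ge> 3\<close>, exactly what \<open>3 choose 2\<close> requires.\<close>
  have "8 / 5 \<le> sqrt pi"
    using pi_gt3 by (intro real_le_rsqrt) (simp add: power2_eq_square)
  moreover have "Gamma (5 / 2 :: real) = 3 / 2 * (1 / 2 * sqrt pi)"
    using Gamma_rec[of "3 / 2"] Gamma_rec[of "1 / 2"] by (simp add: Gamma_one_half_real)
  ultimately have base: "6 / 5 \<le> Gamma (5 / 2 :: real)"
    by simp
  have "?fact j \<and> ?choose j"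
  proof (induction j)
    case 0
    show ?case
      using base by (simp add: numeral_2_eq_2)
  next
    case (Suc j)
    have rec: "Gamma (real (Suc j) + 5 / 2) = (real j + 5 / 2) * Gamma (real j + 5 / 2)"
      using Gamma_rec[of "real j + 5 / 2"] by (simp add: add_ac)
    have "(fact (Suc (Suc j)) :: real) = real (Suc (Suc j)) * fact (Suc j)"
      by (rule fact_Suc)
    also have "\<dots> \<le> (real j + 5 / 2) * Gamma (real j + 5 / 2)"
      using Suc by (intro mult_mono) auto
    finally have "?fact (Suc j)"
      by (simp only: rec)
    moreover have "?choose (Suc j)"
    proof (cases "j = 0")
      case True
      thus ?thesis
        using base unfolding rec by (simp add: numeral_2_eq_2)
    next
      case False
      have "real (Suc (Suc j) choose 2) \<ge> real (Suc j)"
        by (simp add: numeral_2_eq_2)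
      hence "2 \<le> Gamma (real j + 5 / 2)"
        using Suc False by linarith
      hence "(real j + 3 / 2) * 2 \<le> (real j + 3 / 2) * Gamma (real j + 5 / 2)"
        by (intro mult_left_mono) auto
      moreover have "real (Suc (Suc (Suc j)) choose 2) = real (Suc (Suc j)) + real (Suc (Suc j) choose 2)"
        by (simp add: numeral_2_eq_2)
      ultimately show ?thesis
        using Suc unfolding rec by (simp add: algebra_simps)
    qed
    ultimately show ?case ..
  qed
  thus "?fact j" "?choose j"
    by auto
qed

text \<open>The upper bound \<open>1 / fact q\<close> carries the condition
  \<open>q \<le> CARD('a)\<close>: for a field of size n and \<open>q \<ge> n\<close> the maximum in
  that regime is n^(n - 2q), which exceeds 1/q! once q is large.\<close>

theorem theorem6:
  fixes d q :: nat
  shows "\<exists>p. is_max_success_probability TYPE('a::{field,finite}) d q p \<and>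
    (real q \<le> real d / 2 \<longrightarrow> p \<le> 1 / real CARD('a)) \<and>
    (real q = real d / 2 + 1 / 2 \<longrightarrow>
       1 / fact q * (1 - real ((q + 1) choose 2) * (1 / real CARD('a))) \<le> p \<and>
       (q \<le> CARD('a) \<longrightarrow> p \<le> 1 / fact q)) \<and>
    (real q \<ge> real d / 2 + 1 \<longrightarrow>
       p \<ge> 1 - (real_fact (real d / 2 + 1) + real d + 1) / real CARD('a))"
proof -
  define \<rho> where "\<rho> q = real (card (reachable d q :: 'a poly set)) / real CARD('a) ^ (d + 1)" for q
  have many: "1 - (real_fact (real d / 2 + 1) + real d + 1) / real CARD('a) \<le> \<rho> q"
    if q: "real q \<ge> real d / 2 + 1"
  proof -
    \<comment> \<open>More queries never hurt, so the least admissible number \<open>k\<close>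
      suffices: \<open>Suc j\<close> or \<open>Suc (Suc j)\<close> depending on parity.\<close>
    have mono: "\<rho> k \<le> \<rho> q" if "k \<le> q" for k
      unfolding \<rho>_def using card_mono[OF finite_reachable reachable_mono[OF that]]
      by (intro divide_right_mono) auto
    show ?thesis
    proof (cases "even d")
      case True
      then obtain j where d: "d = 2 * j"
        by (elim evenE)
      have g: "real_fact (real d / 2 + 1) = fact (Suc j)"
        using real_fact_of_nat[of "Suc j"] by (simp add: d add.commute)
      have "1 - (real_fact (real d / 2 + 1) + real d + 1) / real CARD('a) \<le> \<rho> (Suc j)"
        unfolding \<rho>_def g
        by (rule reachable_fraction_ge[where r = 1]) (simp_all add: d choose_two_le_fact del: fact_Suc)
      also have "\<dots> \<le> \<rho> q"
        using q by (intro mono) (simp add: d)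
      finally show ?thesis .
    next
      case False
      then obtain j where d: "d = 2 * j + 1"
        by (elim oddE)
      have g: "real_fact (real d / 2 + 1) = Gamma (real j + 5 / 2)"
        by (simp add: real_fact_def d add_divide_distrib add_ac)
      have "1 - (real_fact (real d / 2 + 1) + real d + 1) / real CARD('a) \<le> \<rho> (Suc (Suc j))"
        unfolding \<rho>_def g
      proof (rule reachable_fraction_ge[where r = 2])
        assume "Suc (Suc j) \<le> CARD('a)"
        \<comment> \<open>For odd \<open>d\<close> the Gamma value is only compared with the
          factorial of \<open>k - 1\<close>; the missing factor \<open>k\<close> is paid for by
          \<open>CARD('a)\<close>.\<close>
        hence "fact (Suc j) * real (Suc (Suc j)) \<le> Gamma (real j + 5 / 2) * real CARD('a)"
          by (intro mult_mono Gamma_half_integer_ge) auto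
        thus "fact (Suc (Suc j)) \<le> Gamma (real j + 5 / 2) * real CARD('a) ^ (2 - 1)"
          by (simp add: fact_Suc[of "Suc j"] mult.commute del: fact_Suc of_nat_Suc)
      qed (simp_all only: d Gamma_half_integer_ge, simp_all)
      also have "\<dots> \<le> \<rho> q"
      proof (rule mono)
        have "d + 2 \<le> 2 * q"
          using q by linarith
        thus "Suc (Suc j) \<le> q"
          by (simp add: d)
      qed
      finally show ?thesis .
    qed
  qed
  show ?thesis
  proof (intro exI[of _ "\<rho> q"] conjI impI)
    show "is_max_success_probability TYPE('a) d q (\<rho> q)"
      unfolding \<rho>_def by (rule max_success_probability)
  next
    assume "real q \<le> real d / 2"
    thus "\<rho> q \<le> 1 / real CARD('a)"
      unfolding \<rho>_def by (intro reachable_fraction_le_inverse) linarith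
  next
    assume "real q = real d / 2 + 1 / 2"
    thus "1 / fact q * (1 - real ((q + 1) choose 2) * (1 / real CARD('a))) \<le> \<rho> q"
      unfolding \<rho>_def by (intro reachable_fraction_ge_choose) linarith
  next
    assume "real q = real d / 2 + 1 / 2" "q \<le> CARD('a)"
    thus "\<rho> q \<le> 1 / fact q"
      unfolding \<rho>_def by (intro reachable_fraction_le_fact) linarith+
  next
    assume "real q \<ge> real d / 2 + 1"
    thus "1 - (real_fact (real d / 2 + 1) + real d + 1) / real CARD('a) \<le> \<rho> q"
      by (rule many)
  qed
qed

end
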